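(* Let $\mathcal M\subset\mathbb R^d$ be a smooth compact submanifold with reach $\tau$, let $\mathbf m,\mathbf z\in\mathcal M$ and let $\mathbf v\in N_{\mathbf m}\mathcal M$ with $\|\mathbf v\|_2<\tau$. Then $$\|\mathrm dP_{\mathcal M}(\mathbf m+\mathbf v)-\mathrm dP_{\mathcal M}(\mathbf z)\|_2\le\frac1\tau\|\mathbf m-\mathbf z\|_2+\frac{1}{\tau-\|\mathbf v\|_2}\|\mathbf v\|_2\le\left(\frac2\tau+\frac1{\tau-\|\mathbf v\|_2}\right)\|\mathbf m+\mathbf v-\mathbf z\|_2.$$
   Context: $\mathcal M\subset\mathbb R^d$ is a smooth compact Riemannian submanifold (induced metric) with tangent spaces $T_{\mathbf m}\mathcal M$ and normal spaces $N_{\mathbf m}\mathcal M=(T_{\mathbf m}\mathcal M)^\perp$. Its reach $\tau>0$ is the maximal constant such that $E(\mathbf m,\mathbf v)=\mathbf m+\mathbf v$ is injective on $V=\{(\mathbf m,\mathbf v):\mathbf m\in\mathcal M,\ \mathbf v\in N_{\mathbf m}\mathcal M,\ \|\mathbf v\|_2<\tau\}$. On the tubular neighborhood $U=E(V)$, $P_{\mathcal M}(\mathbf x)=\operatorname{argmin}_{\mathbf m\in\mathcal M}\|\mathbf x-\mathbf m\|_2$ is a well-defined smooth map, and $\mathrm dP_{\mathcal M}(\mathbf x)\colon\mathbb R^d\to\mathbb R^d$ is its differential. The norm $\|\cdot\|_2$ is the Euclidean norm for vectors and the spectral (operator) norm for linear maps. *)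

theory Defs
  imports "HOL-Analysis.Analysis"
begin

text \<open>\<^term>\<open>Ck_on n S f\<close> is only meant for open \<^term>\<open>S\<close>, where differentiability at a point
  and within \<^term>\<open>S\<close> agree.\<close>

primrec Ck_on :: "nat \<Rightarrow> 'a::euclidean_space set \<Rightarrow> ('a \<Rightarrow> 'b::euclidean_space) \<Rightarrow> bool" where
  "Ck_on 0 S f \<longleftrightarrow> continuous_on S f"
| "Ck_on (Suc n) S f \<longleftrightarrow>
     (\<forall>x\<in>S. f differentiable (at x)) \<and> (\<forall>h. Ck_on n S (\<lambda>x. frechet_derivative f (at x) h))"

definition smooth_on :: "'a::euclidean_space set \<Rightarrow> ('a \<Rightarrow> 'b::euclidean_space) \<Rightarrow> bool" where
  "smooth_on S f \<longleftrightarrow> (\<forall>n. Ck_on n S f)"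

text \<open>Embedded submanifolds without boundary, described by slice charts: near each of its points
  \<^term>\<open>M\<close> is carried onto an open piece of a \<^term>\<open>k\<close>-dimensional linear subspace by a
  diffeomorphism between open sets of the ambient space.\<close>

definition smooth_submanifold :: "nat \<Rightarrow> 'a::euclidean_space set \<Rightarrow> bool" where
  "smooth_submanifold k M \<longleftrightarrow>
     (\<forall>p\<in>M. \<exists>(U::'a set) (W::'a set) \<phi> \<psi> L.
        open U \<and> p \<in> U \<and> open W \<and>
        homeomorphism U W \<phi> \<psi> \<and> smooth_on U \<phi> \<and> smooth_on W \<psi> \<and>
        subspace L \<and> dim L = k \<and> \<phi> ` (U \<inter> M) = W \<inter> L)"

text \<open>Tangent vectors are the velocities of smooth curves in \<^term>\<open>M\<close>.\<close>

definition tangent_space_at :: "'a::euclidean_space set \<Rightarrow> 'a \<Rightarrow> 'a set" where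
  "tangent_space_at M p =
     {w. \<exists>c e. 0 < e \<and> smooth_on {-e<..<e} c \<and> c ` {-e<..<e} \<subseteq> M \<and> c (0::real) = p \<and>
               (c has_vector_derivative w) (at 0)}"

definition normal_space_at :: "'a::euclidean_space set \<Rightarrow> 'a \<Rightarrow> 'a set" where
  "normal_space_at M p = orthogonal_comp (tangent_space_at M p)"

definition normal_tube :: "'a::euclidean_space set \<Rightarrow> ereal \<Rightarrow> ('a \<times> 'a) set" where
  "normal_tube M r = {(p, v). p \<in> M \<and> v \<in> normal_space_at M p \<and> ereal (norm v) < r}"

text \<open>The reach is extended-real-valued because that of a single point is infinite. The supremum
  is attained, so it is the maximal radius of injectivity.\<close>

definition reach :: "'a::euclidean_space set \<Rightarrow> ereal" where
  "reach M = Sup {r. inj_on (\<lambda>(p, v). p + v) (normal_tube M r)}"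

lemma inj_on_normal_tube_iff_le_reach:
  "inj_on (\<lambda>(p, v). p + v) (normal_tube M r) \<longleftrightarrow> r \<le> reach M"
proof
  assume "inj_on (\<lambda>(p, v). p + v) (normal_tube M r)"
  then show "r \<le> reach M"
    by (auto simp: reach_def intro: Sup_upper)
next
  assume r: "r \<le> reach M"
  show "inj_on (\<lambda>(p, v). p + v) (normal_tube M r)"
  proof (rule inj_onI)
    fix x y assume xy: "x \<in> normal_tube M r" "y \<in> normal_tube M r"
      and eq: "(\<lambda>(p, v). p + v) x = (\<lambda>(p, v). p + v) y"
    define a where "a = max (ereal (norm (snd x))) (ereal (norm (snd y)))"
    have "a < reach M"
      using xy r unfolding a_def normal_tube_def by (auto intro: less_le_trans)
    then obtain s where s: "inj_on (\<lambda>(p, v). p + v) (normal_tube M s)" "a < s"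
      by (auto simp: reach_def less_Sup_iff)
    have "x \<in> normal_tube M s" "y \<in> normal_tube M s"
      using xy s(2) by (auto simp: normal_tube_def a_def)
    then show "x = y"
      using s(1) eq by (auto dest: inj_onD)
  qed
qed

end

theory Submission
  imports Defs
begin

text \<open>For \<open>r \<le> \<tau>\<close>, injectivity of the normal tube keeps \<open>M\<close> outside every open ball of radius \<open>r\<close>
  tangent to \<open>M\<close>; to second order in a chart this bounds the second fundamental form by \<open>1 / r\<close>.
  Differentiating the equation \<open>x - P x \<bottom> T\<close> shows that \<open>dP (m + v)\<close> differs from the tangential
  projection \<open>dP m\<close> by at most \<open>norm v / (r - norm v)\<close>. To compare tangential projections \<open>Q\<close> at
  \<open>m\<close> and \<open>z\<close>, project the chord from \<open>m\<close> to \<open>z\<close> to \<open>M\<close>. Along the resulting curve the reflection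
  \<open>2 Q - 1\<close> moves a unit vector on the sphere with speed at most \<open>2 \<xi>\<close>, where
  \<open>\<xi> = a / sqrt (1 - a\<^sup>2 / 4)\<close> and \<open>a = norm (m - z) / r\<close>, so the projections differ by at most
  \<open>sin \<xi> \<le> a\<close>. The slack in the last inequality absorbs the loss from using the projected chord instead
  of a geodesic.\<close>

subsection \<open>Calculus\<close>

text \<open>Since \<open>\<tau>\<close> may be infinite, the analysis is carried out for a finite
  real \<open>r\<close> with \<open>norm v < r \<le> \<tau>\<close>; at the end \<open>r\<close> is
  \<open>\<tau>\<close> itself or tends to infinity. The tangent ball inequality is all that is kept
  of the reach. It acts twice: globally it pins down the closest point on the tube and makes it
  continuous there, and infinitesimally it bounds the second fundamental form. The continuity is
  what the implicit function argument needs, because there the closest point is an already given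
  solution that only has to be differentiated. The obstacle in comparing projections is the sharp
  constant \<open>1 / r\<close>. Integrating the speed of the projections along the projected chord
  gives \<open>\<xi>\<close>, which is larger than \<open>a\<close>. The reflections turn a speed
  bound into an angle on a sphere, and the straight distance between the endpoints then brings in
  the sine.\<close>

lemma second_difference_tendsto:
  fixes f :: "'a::real_normed_vector \<Rightarrow> real"
  assumes "open S" "y \<in> S"
    and f: "\<And>x. x \<in> S \<Longrightarrow> (f has_derivative f' x) (at x)"
    and A: "((\<lambda>x. f' x a) has_derivative A) (at y)"
  shows "((\<lambda>s. (f (y + s *\<^sub>R a + s *\<^sub>R b) - f (y + s *\<^sub>R a) - f (y + s *\<^sub>R b) + f y) / s\<^sup>2)
           \<longlongrightarrow> A b) (at_right 0)"
proof (rule tendstoI)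
  fix \<epsilon> :: real assume "\<epsilon> > 0"
  \<comment> \<open>\<open>s * K\<close> bounds the sum of the distances from \<open>y\<close> of
    the two points at which the derivative is evaluated below; the summand 1 keeps \<open>K\<close>
    positive.\<close>
  define K where "K = 2 * norm a + norm b + 1"
  have K: "K > 0" by (auto simp: K_def intro: add_nonneg_pos)
  define e where "e = \<epsilon> / (2 * K)"
  have e: "e > 0" using K \<open>\<epsilon> > 0\<close> by (simp add: e_def)
  interpret A: bounded_linear A using A by (rule has_derivative_bounded_linear)
  obtain d1 where d1: "d1 > 0"
    "\<And>x. norm (x - y) < d1 \<Longrightarrow> norm (f' x a - f' y a - A (x - y)) \<le> e * norm (x - y)"
    using A e unfolding has_derivative_at_alt by blast
  obtain d2 where d2: "d2 > 0" "ball y d2 \<subseteq> S"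
    using \<open>open S\<close> \<open>y \<in> S\<close> openE by blast
  define d where "d = min d1 d2 / K"
  have d: "d > 0" using d1 d2 K by (simp add: d_def)
  have "dist ((f (y + s *\<^sub>R a + s *\<^sub>R b) - f (y + s *\<^sub>R a) - f (y + s *\<^sub>R b) + f y) / s\<^sup>2) (A b) < \<epsilon>"
    if s: "0 < s" "s < d" for s
  proof -
    have sK: "s * K < d1" "s * K < d2"
      using s K by (auto simp: d_def field_simps)
    have small: "norm (t *\<^sub>R a + u *\<^sub>R b) \<le> s * (norm a + norm b)" if "0 \<le> t" "t \<le> s" "0 \<le> u" "u \<le> s" for t u
    proof -
      have "norm (t *\<^sub>R a + u *\<^sub>R b) \<le> t * norm a + u * norm b"
        using norm_triangle_ineq[of "t *\<^sub>R a" "u *\<^sub>R b"] that by simp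
      also have "\<dots> \<le> s * norm a + s * norm b"
        using that by (intro add_mono mult_right_mono) auto
      finally show ?thesis by (simp add: algebra_simps)
    qed
    have sK': "s * (norm a + norm b) < s * K"
      using s by (intro mult_strict_left_mono) (auto simp: K_def intro: add_nonneg_pos)
    have inS: "y + t *\<^sub>R a + u *\<^sub>R b \<in> S" if "0 \<le> t" "t \<le> s" "0 \<le> u" "u \<le> s" for t u
      using small[OF that] sK sK' d2(2) by (intro subsetD[OF d2(2)]) (auto simp: dist_norm algebra_simps norm_minus_commute)
    \<comment> \<open>The second difference is \<open>g s - g 0\<close>. One mean value step in
      direction \<open>a\<close> turns it into a difference of two values of \<open>f' x a\<close>,
      and both are compared with the linearisation \<open>A\<close> at \<open>y\<close>.\<close>
    define g where "g = (\<lambda>t. f (y + t *\<^sub>R a + s *\<^sub>R b) - f (y + t *\<^sub>R a))"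
    have "\<exists>t\<in>{0<..<s}. g s - g 0 = (\<lambda>h. h * (f' (y + t *\<^sub>R a + s *\<^sub>R b) a - f' (y + t *\<^sub>R a) a)) (s - 0)"
    proof (rule mvt_simple[OF s(1), where f'="\<lambda>t h. h * (f' (y + t *\<^sub>R a + s *\<^sub>R b) a - f' (y + t *\<^sub>R a) a)"])
      fix t assume "0 \<le> t" "t \<le> s"
      then have t: "t \<in> {0..s}" by simp
      let ?p = "y + t *\<^sub>R a + s *\<^sub>R b" and ?q = "y + t *\<^sub>R a"
      have p: "?p \<in> S" and q: "?q \<in> S"
        using inS[of t s] inS[of t 0] t s by auto
      interpret P: bounded_linear "f' ?p" using f[OF p] by (rule has_derivative_bounded_linear)
      interpret Q: bounded_linear "f' ?q" using f[OF q] by (rule has_derivative_bounded_linear)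
      have "((\<lambda>t. f (y + t *\<^sub>R a + s *\<^sub>R b)) has_derivative (\<lambda>h. f' ?p (h *\<^sub>R a))) (at t)"
        by (rule has_derivative_compose[where f="\<lambda>t. y + t *\<^sub>R a + s *\<^sub>R b", OF _ f[OF p]])
          (auto intro!: derivative_eq_intros)
      moreover have "((\<lambda>t. f (y + t *\<^sub>R a)) has_derivative (\<lambda>h. f' ?q (h *\<^sub>R a))) (at t)"
        by (rule has_derivative_compose[where f="\<lambda>t. y + t *\<^sub>R a", OF _ f[OF q]])
          (auto intro!: derivative_eq_intros)
      ultimately have "(g has_derivative (\<lambda>h. f' ?p (h *\<^sub>R a) - f' ?q (h *\<^sub>R a))) (at t)"
        unfolding g_def by (rule has_derivative_diff)
      moreover have "(\<lambda>h. f' ?p (h *\<^sub>R a) - f' ?q (h *\<^sub>R a)) = (\<lambda>h. h * (f' ?p a - f' ?q a))"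
        by (simp add: P.scaleR Q.scaleR right_diff_distrib)
      ultimately show "(g has_derivative (\<lambda>h. h * (f' ?p a - f' ?q a))) (at t within {0..s})"
        by (auto intro: has_derivative_at_withinI)
    qed
    then obtain t where t: "0 < t" "t < s"
      and gt: "g s - g 0 = s * (f' (y + t *\<^sub>R a + s *\<^sub>R b) a - f' (y + t *\<^sub>R a) a)"
      by auto
    let ?p = "t *\<^sub>R a + s *\<^sub>R b" and ?q = "t *\<^sub>R a"
    have np: "norm ?p \<le> s * (norm a + norm b)" and nq: "norm ?q \<le> s * norm a"
      using small[of t s] t s by (auto intro: mult_right_mono)
    have "norm ?q \<le> s * (norm a + norm b)"
      using small[of t 0] t s by auto
    then have "norm (f' (y + ?p) a - f' y a - A ?p) \<le> e * norm ?p"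
      "norm (f' (y + ?q) a - f' y a - A ?q) \<le> e * norm ?q"
      using d1(2)[of "y + ?p"] d1(2)[of "y + ?q"] np sK sK' by auto
    moreover have "e * norm ?p + e * norm ?q \<le> e * (s * K)"
      using np nq e s unfolding distrib_left[symmetric]
      by (intro mult_left_mono) (auto simp: K_def algebra_simps)
    moreover have "A ?p - A ?q = s * A b"
      by (simp add: A.add A.scaleR)
    ultimately have "\<bar>f' (y + ?p) a - f' (y + ?q) a - s * A b\<bar> \<le> e * (s * K)"
      by (smt (verit) real_norm_def)
    then have "\<bar>s * (f' (y + ?p) a - f' (y + ?q) a) - s\<^sup>2 * A b\<bar> \<le> s * (e * (s * K))"
      using s by (simp add: power2_eq_square mult.assoc right_diff_distrib[symmetric] abs_mult)
    then have "\<bar>g s - g 0 - s\<^sup>2 * A b\<bar> \<le> s\<^sup>2 * (e * K)"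
      unfolding gt by (simp add: add.assoc power2_eq_square algebra_simps)
    also have "e * K = \<epsilon> / 2" using K by (simp add: e_def)
    finally have "\<bar>(g s - g 0) / s\<^sup>2 - A b\<bar> \<le> \<epsilon> / 2"
      using s by (simp add: field_simps abs_div_pos[symmetric] abs_le_iff)
    moreover have "g s - g 0 = f (y + s *\<^sub>R a + s *\<^sub>R b) - f (y + s *\<^sub>R a) - f (y + s *\<^sub>R b) + f y"
      by (simp add: g_def)
    ultimately show ?thesis using \<open>\<epsilon> > 0\<close> by (simp add: dist_real_def)
  qed
  then show "\<forall>\<^sub>F s in at_right 0. dist ((f (y + s *\<^sub>R a + s *\<^sub>R b) - f (y + s *\<^sub>R a) - f (y + s *\<^sub>R b) + f y) / s\<^sup>2) (A b) < \<epsilon>"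
    unfolding eventually_at_right_field using d by auto
qed

text \<open>The second difference quotient does not change when \<open>a\<close> and
  \<open>b\<close> are exchanged, so its limit is both mixed derivatives.\<close>

lemma second_derivative_symmetric:
  fixes f :: "'a::real_normed_vector \<Rightarrow> real"
  assumes "open S" "y \<in> S"
    and f: "\<And>x. x \<in> S \<Longrightarrow> (f has_derivative f' x) (at x)"
    and "((\<lambda>x. f' x a) has_derivative A) (at y)" "((\<lambda>x. f' x b) has_derivative B) (at y)"
  shows "A b = B a"
proof (rule tendsto_unique[OF _ second_difference_tendsto[OF assms(1-4)]])
  show "((\<lambda>s. (f (y + s *\<^sub>R a + s *\<^sub>R b) - f (y + s *\<^sub>R a) - f (y + s *\<^sub>R b) + f y) / s\<^sup>2)
           \<longlongrightarrow> B a) (at_right 0)"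
    using second_difference_tendsto[OF assms(1-3) assms(5), of a] by (simp add: algebra_simps)
qed simp

text \<open>A negative \<open>D\<close> would make \<open>g'\<close> negative just to the right of
  the critical point 0, and \<open>g\<close> would fall below its minimum.\<close>

lemma second_derivative_nonneg_at_min:
  fixes g g' :: "real \<Rightarrow> real"
  assumes "0 < d" and g: "\<And>s. \<bar>s\<bar> < d \<Longrightarrow> (g has_real_derivative g' s) (at s)"
    and D: "(g' has_real_derivative D) (at 0)"
    and min: "\<And>s. \<bar>s\<bar> < d \<Longrightarrow> g 0 \<le> g s"
  shows "0 \<le> D"
proof (rule ccontr)
  assume "\<not> 0 \<le> D"
  then obtain e where e: "e > 0" "\<And>h. 0 < h \<Longrightarrow> h < e \<Longrightarrow> g' h < g' 0"
    using DERIV_neg_dec_right[OF D] by auto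
  have "g' 0 = 0"
    by (rule DERIV_local_min[OF g[of 0] \<open>0 < d\<close>]) (use \<open>0 < d\<close> min in auto)
  define h where "h = min d e / 2"
  have h: "0 < h" "h < d" "h < e" using \<open>0 < d\<close> e(1) by (auto simp: h_def)
  obtain t where "0 < t" "t < h" "g h - g 0 = (h - 0) * g' t"
    using MVT2[OF h(1), of g g'] g h by auto
  then show False
    using e(2)[of t] h min[of h] \<open>g' 0 = 0\<close> by (smt (verit) mult_pos_neg)
qed

text \<open>The solution \<open>y\<close> is given and continuous, so only its derivative is sought.
  The partial derivative \<open>C\<close> in the second variable is invertible, which determines
  \<open>Y\<close> from the linearised equation; its lower bound \<open>c\<close> converts the error
  in the equation into an error in \<open>y\<close>.\<close>

lemma has_derivative_implicit:
  fixes G :: "'a::real_normed_vector \<times> 'b::euclidean_space \<Rightarrow> 'b" and y :: "'a \<Rightarrow> 'b"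
  assumes D: "(G has_derivative D) (at (x0, y x0))"
    and inj: "\<And>k. D (0, k) = 0 \<Longrightarrow> k = 0"
    and cont: "isCont y x0"
    and zero: "\<forall>\<^sub>F x in nhds x0. G (x, y x) = 0"
  shows "\<exists>Y. (y has_derivative Y) (at x0) \<and> (\<forall>h. D (h, Y h) = 0)"
proof -
  interpret D: bounded_linear D using D by (rule has_derivative_bounded_linear)
  define C where "C = (\<lambda>k. D (0, k))"
  have D_split: "D (h, k) = D (h, 0) + C k" for h k
    using D.add[of "(h, 0)" "(0, k)"] by (simp add: C_def)
  have linC: "linear C"
    unfolding C_def using D.add[of "(0,_)" "(0,_)"] D.scaleR[of _ "(0,_)"] by (intro linearI) auto
  then have injC: "inj C"
    using inj unfolding linear_injective_0[OF linC] by (simp add: C_def)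
  obtain c where c: "c > 0" "\<And>k. c * norm k \<le> norm (C k)"
    using linear_inj_bounded_below_pos[OF linC injC] by blast
  obtain C' where C': "linear C'" "\<And>k. C (C' k) = k"
    using linear_injective_isomorphism[OF linC injC] by auto
  define Y where "Y = (\<lambda>h. - C' (D (h, 0)))"
  have blY: "bounded_linear Y"
    unfolding Y_def
    by (intro bounded_linear_minus bounded_linear_compose[OF C'(1)[unfolded linear_conv_bounded_linear]]
        bounded_linear_compose[OF D.bounded_linear_axioms] bounded_linear_Pair bounded_linear_ident bounded_linear_zero)
  have DY: "D (h, Y h) = 0" for h
    by (subst D_split) (simp add: Y_def linear_neg[OF linC] C'(2))
  obtain K where K: "K > 0" "\<And>h. norm (Y h) \<le> norm h * K"
    using bounded_linear.pos_bounded[OF blY] by auto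
  have "\<exists>d>0. \<forall>x. norm (x - x0) < d \<longrightarrow> norm (y x - y x0 - Y (x - x0)) \<le> e * norm (x - x0)"
    if "e > 0" for e
  proof -
    \<comment> \<open>The bound \<open>c / 2\<close> lets the left side absorb the unknown error
      \<open>norm (?k - Y ?h)\<close>; the other bound leaves at most \<open>e * norm ?h\<close>
      after division by \<open>c / 2\<close>.\<close>
    define \<eta> where "\<eta> = min (c / 2) (e * c / (2 * (1 + K)))"
    have \<eta>: "\<eta> > 0" "\<eta> \<le> c / 2" "\<eta> * (1 + K) \<le> e * c / 2"
    proof -
    have "\<eta> * (1 + K) \<le> e * c / (2 * (1 + K)) * (1 + K)"
      using K by (intro mult_right_mono) (auto simp: \<eta>_def)
    moreover have "e * c / (2 * (1 + K)) * (1 + K) = e * c / 2"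
      using K(1) by (simp add: field_simps)
    ultimately show "\<eta> * (1 + K) \<le> e * c / 2" by (rule ord_le_eq_trans)
  next
    show "0 < \<eta>" using c(1) K(1) that by (simp add: \<eta>_def)
    show "\<eta> \<le> c / 2" unfolding \<eta>_def by (rule min.cobounded1)
  qed
    obtain d1 where d1: "d1 > 0" "\<And>z. norm (z - (x0, y x0)) < d1 \<Longrightarrow>
        norm (G z - G (x0, y x0) - D (z - (x0, y x0))) \<le> \<eta> * norm (z - (x0, y x0))"
      using D \<eta>(1) unfolding has_derivative_at_alt by blast
    have "\<forall>\<^sub>F x in nhds x0. dist (y x) (y x0) < d1 / 2"
      using tendstoD[OF cont[unfolded continuous_at] half_gt_zero[OF d1(1)]] d1(1)
      by (simp add: eventually_at_filter) (auto elim: eventually_mono)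
    moreover have "\<forall>\<^sub>F x in nhds x0. dist x x0 < d1 / 2"
      using d1(1) eventually_nhds_metric half_gt_zero by blast
    ultimately have "\<forall>\<^sub>F x in nhds x0. G (x, y x) = 0 \<and> dist (y x) (y x0) < d1 / 2 \<and> dist x x0 < d1 / 2"
      using zero by eventually_elim auto
    then obtain d where d: "d > 0" "\<And>x. dist x x0 < d \<Longrightarrow> G (x, y x) = 0 \<and> dist (y x) (y x0) < d1 / 2 \<and> dist x x0 < d1 / 2"
      unfolding eventually_nhds_metric by blast
    have "norm (y x - y x0 - Y (x - x0)) \<le> e * norm (x - x0)" if x: "norm (x - x0) < d" for x
    proof -
      let ?h = "x - x0" and ?k = "y x - y x0"
      have le: "norm (?h, ?k) \<le> norm ?h + norm ?k"
        by (rule norm_Pair_le)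
      have "G (x, y x) = 0" "G (x0, y x0) = 0" "norm ?k < d1 / 2" "norm ?h < d1 / 2"
        using d(2)[of x] d(2)[of x0] x d(1) by (auto simp: dist_norm)
      then have "norm (D (?h, ?k)) \<le> \<eta> * norm (?h, ?k)"
        using d1(2)[of "(x, y x)"] le by simp
      also have "\<dots> \<le> \<eta> * (norm ?h + norm ?k)"
        using le \<eta> by (intro mult_left_mono) auto
      also have "\<dots> \<le> \<eta> * (norm ?h + (norm (?k - Y ?h) + norm ?h * K))"
        using K(2)[of ?h] norm_triangle_sub[of ?k "Y ?h"] \<eta> by (intro mult_left_mono) auto
      finally have 1: "norm (D (?h, ?k)) \<le> \<eta> * (1 + K) * norm ?h + \<eta> * norm (?k - Y ?h)"
        by (simp add: algebra_simps)
      have "D (?h, ?k) = C (?k - Y ?h)"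
        using DY[of ?h] D_split[of ?h ?k] D_split[of ?h "Y ?h"]
        by (simp add: linear_diff[OF linC] eq_neg_iff_add_eq_0)
      then have "c * norm (?k - Y ?h) \<le> \<eta> * (1 + K) * norm ?h + \<eta> * norm (?k - Y ?h)"
        using c(2)[of "?k - Y ?h"] 1 by simp
      also have "\<dots> \<le> e * c / 2 * norm ?h + c / 2 * norm (?k - Y ?h)"
        using \<eta> by (intro add_mono mult_right_mono) auto
      finally have "c / 2 * norm (?k - Y ?h) \<le> c / 2 * (e * norm ?h)"
        by (simp add: algebra_simps)
      then show ?thesis
        using c(1) by (simp only: mult_le_cancel_left_pos half_gt_zero)
    qed
    then show ?thesis using d(1) by blast
  qed
  then have "(y has_derivative Y) (at x0)"
    unfolding has_derivative_at_alt using blY by blast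
  then show ?thesis using DY by blast
qed

text \<open>\<open>q x\<close> is the orthogonal projection of \<open>f x\<close> onto the span of a
  moving frame. In the induction the new frame vector minus its projection onto the old span is
  \<open>g\<close>; independence makes \<open>g s\<close> nonzero, so dividing by
  \<open>g x \<bullet> g x\<close> preserves differentiability at \<open>s\<close>.\<close>

lemma differentiable_gram_schmidt:
  fixes c :: "'i \<Rightarrow> 'a::real_normed_vector \<Rightarrow> 'b::real_inner"
  assumes "finite B" "\<And>b. b \<in> B \<Longrightarrow> c b differentiable (at s)"
    and "inj_on (\<lambda>b. c b s) B" "independent ((\<lambda>b. c b s) ` B)"
    and "f differentiable (at s)"
  shows "\<exists>q. q differentiable (at s) \<and>
           (\<forall>x. q x \<in> span ((\<lambda>b. c b x) ` B) \<and> (\<forall>b\<in>B. (f x - q x) \<bullet> c b x = 0))"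
  using assms
proof (induction B arbitrary: f rule: finite_induct)
  case empty
  then show ?case by (intro exI[of _ "\<lambda>_. 0"]) auto
next
  case (insert b B)
  have notin: "c b s \<notin> (\<lambda>b. c b s) ` B"
    using insert.hyps insert.prems(2) by (auto simp: inj_on_def)
  then have ind: "c b s \<notin> span ((\<lambda>b. c b s) ` B)" "independent ((\<lambda>b. c b s) ` B)"
    using insert.prems(3) by (auto simp: independent_insert)
  obtain qf where qf: "qf differentiable (at s)" "\<And>x. qf x \<in> span ((\<lambda>b. c b x) ` B)"
    "\<And>x b. b \<in> B \<Longrightarrow> (f x - qf x) \<bullet> c b x = 0"
    using insert.IH[of f] insert.prems ind by (auto simp: inj_on_def)
  obtain qb where qb: "qb differentiable (at s)" "\<And>x. qb x \<in> span ((\<lambda>b. c b x) ` B)"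
    "\<And>x b'. b' \<in> B \<Longrightarrow> (c b x - qb x) \<bullet> c b' x = 0"
    using insert.IH[of "c b"] insert.prems ind by (auto simp: inj_on_def)
  define g where "g = (\<lambda>x. c b x - qb x)"
  have gs: "g s \<noteq> 0" using ind(1) qb(2)[of s] by (auto simp: g_def)
  have g_diff: "g differentiable (at s)"
    unfolding g_def using qb(1) insert.prems(1) by (intro differentiable_diff) auto
  have orth_span: "w \<bullet> z = 0" if "\<And>b. b \<in> B \<Longrightarrow> w \<bullet> c b x = 0" "z \<in> span ((\<lambda>b. c b x) ` B)" for w z x
    using that(2) by (induction rule: span_induct_alt) (use that(1) in \<open>auto simp: inner_add_right\<close>)
  text \<open>Where \<open>g x = 0\<close> the quotient is \<open>0 / 0 = 0\<close>, and \<open>qf x\<close> is already the projection.\<close>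
  define q where "q = (\<lambda>x. qf x + ((f x \<bullet> g x) / (g x \<bullet> g x)) *\<^sub>R g x)"
  have inner_diff: "(\<lambda>x. u x \<bullet> g x) differentiable (at s)" if "u differentiable (at s)" for u
    using has_derivative_inner[OF that[unfolded frechet_derivative_works] g_diff[unfolded frechet_derivative_works]]
    by (rule differentiableI)
  have "(\<lambda>x. g x \<bullet> g x) differentiable (at s)" "(\<lambda>x. f x \<bullet> g x) differentiable (at s)"
    using inner_diff g_diff insert.prems(4) by blast+
  then have q_diff: "q differentiable (at s)"
    unfolding q_def using qf(1) g_diff gs
    by (intro differentiable_add differentiable_scaleR differentiable_divide) auto
  have q_span: "q x \<in> span ((\<lambda>b. c b x) ` insert b B)" for x
  proof -
    have "span ((\<lambda>b. c b x) ` B) \<subseteq> span ((\<lambda>b. c b x) ` insert b B)"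
      by (intro span_mono) auto
    then show ?thesis
      unfolding q_def g_def
      by (intro span_add span_scale span_diff) (use qf(2)[of x] qb(2)[of x] in \<open>auto intro: span_base\<close>)
  qed
  have fq: "(f x - q x) \<bullet> c b' x = 0" if "b' \<in> B" for b' x
    using qf(3)[OF that] qb(3)[OF that] by (simp add: q_def g_def inner_diff_left inner_add_left)
  have "(f x - q x) \<bullet> c b x = 0" for x
  proof -
    have "(f x - q x) \<bullet> qb x = 0"
      using orth_span[OF fq qb(2)] by blast
    moreover have "qf x \<bullet> g x = 0"
      using orth_span[of "g x" x "qf x"] qb(3) qf(2) by (auto simp: g_def inner_commute)
    then have "(f x - q x) \<bullet> g x = 0"
      by (cases "g x = 0") (auto simp: q_def inner_diff_left inner_add_left)
    ultimately show ?thesis by (simp add: g_def inner_diff_right)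
  qed
  then show ?case
    using q_diff q_span fq by (intro exI[of _ q]) auto
qed

text \<open>The angle \<open>arccos (f s)\<close> from the starting vector grows at rate at most
  \<open>\<mu>\<close>: the factor \<open>sqrt (1 - (f s)\<^sup>2)\<close> in the bound for the
  derivative of \<open>f\<close> cancels the denominator in the derivative of
  \<open>arccos\<close>.\<close>

lemma inner_ge_cos_speed_on_sphere:
  fixes w :: "real \<Rightarrow> 'a::real_inner"
  assumes w: "\<And>s. s \<in> {0..1} \<Longrightarrow> (w has_vector_derivative w' s) (at s within {0..1})"
    and unit: "\<And>s. s \<in> {0..1} \<Longrightarrow> norm (w s) = 1"
    and speed: "\<And>s. s \<in> {0..1} \<Longrightarrow> norm (w' s) \<le> \<mu>"
    and "\<mu> \<le> pi"
  shows "cos \<mu> \<le> w 0 \<bullet> w 1"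
proof -
  define f where "f = (\<lambda>s. w 0 \<bullet> w s)"
  have f_le: "\<bar>f s\<bar> \<le> 1" if "s \<in> {0..1}" for s
    using Cauchy_Schwarz_ineq2[of "w 0" "w s"] unit that by (auto simp: f_def)
  have \<mu>: "0 \<le> \<mu>" using speed[of 0] norm_ge_zero[of "w' 0"] by (simp del: norm_ge_zero)
  have f': "(f has_real_derivative w 0 \<bullet> w' s) (at s within {0..1})" if "s \<in> {0..1}" for s
    unfolding f_def has_real_derivative_iff_has_vector_derivative
    using bounded_linear.has_vector_derivative[OF bounded_linear_inner_right w[OF that]] .
  have perp: "w s \<bullet> w' s = 0" if s: "s \<in> {0..1}" for s
  proof -
    have "((\<lambda>s. w s \<bullet> w s) has_vector_derivative w s \<bullet> w' s + w' s \<bullet> w s) (at s within {0..1})"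
      by (rule bounded_bilinear.has_vector_derivative[OF bounded_bilinear_inner w[OF s] w[OF s]])
    moreover have "((\<lambda>s. w s \<bullet> w s) has_vector_derivative 0) (at s within {0..1})"
      by (rule has_vector_derivative_transform[OF s, where f="\<lambda>_. 1"])
        (use unit in \<open>auto simp: dot_square_norm\<close>)
    ultimately have "w s \<bullet> w' s + w' s \<bullet> w s = 0"
      using vector_derivative_unique_within_closed_interval[of 0 1 s] s by (auto simp: box_real)
    then show ?thesis by (simp add: inner_commute)
  qed
  have f'_bound: "\<bar>w 0 \<bullet> w' s\<bar> \<le> \<mu> * sqrt (1 - (f s)\<^sup>2)" if s: "s \<in> {0..1}" for s
  proof -
    \<comment> \<open>The velocity is orthogonal to \<open>w s\<close>, so only the component of
      \<open>w 0\<close> orthogonal to \<open>w s\<close> contributes, and its length is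
      \<open>sqrt (1 - (f s)\<^sup>2)\<close>.\<close>
    have "w 0 \<bullet> w' s = (w 0 - f s *\<^sub>R w s) \<bullet> w' s"
      using perp[OF s] by (simp add: inner_diff_left)
    then have "\<bar>w 0 \<bullet> w' s\<bar> \<le> norm (w 0 - f s *\<^sub>R w s) * norm (w' s)"
      using Cauchy_Schwarz_ineq2 by metis
    also have "\<dots> \<le> norm (w 0 - f s *\<^sub>R w s) * \<mu>"
      using speed[OF s] by (intro mult_left_mono) auto
    also have "(norm (w 0 - f s *\<^sub>R w s))\<^sup>2 = 1 - (f s)\<^sup>2"
      using unit[OF s] unit[of 0] unfolding power2_norm_eq_inner
      by (simp add: inner_diff_left inner_diff_right norm_eq_1 f_def inner_commute power2_eq_square)
    then have "norm (w 0 - f s *\<^sub>R w s) = sqrt (1 - (f s)\<^sup>2)"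
      by (metis norm_ge_zero real_sqrt_unique)
    finally show ?thesis by (simp add: mult.commute)
  qed
  text \<open>The factor \<open>c < 1\<close> keeps \<open>arccos\<close> away from its singularities at \<open>f = 1\<close> and \<open>f = -1\<close>.\<close>
  have main: "arccos (c * f 1) \<le> arccos c + \<mu>" if c: "0 < c" "c < 1" for c
  proof -
    have cf: "\<bar>c * f s\<bar> < 1" if "s \<in> {0..1}" for s
      using f_le[OF that] c by (simp add: abs_mult mult_le_one) (smt (verit) mult_left_le)
    define D where "D = (\<lambda>s. inverse (- sqrt (1 - (c * f s)\<^sup>2)) * (c * (w 0 \<bullet> w' s)))"
    have "\<exists>t\<in>{0<..<1}. arccos (c * f 1) - arccos (c * f 0) = (\<lambda>h. D t * h) (1 - 0)"
    proof (rule mvt_simple[where f'="\<lambda>t h. D t * h"])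
      fix s :: real assume "0 \<le> s" "s \<le> 1"
      then have s: "s \<in> {0..1}" by simp
      have "((\<lambda>s. arccos (c * f s)) has_real_derivative D s) (at s within {0..1})"
        unfolding D_def
        by (rule DERIV_chain2[OF DERIV_arccos])
          (use cf[OF s] f'[OF s] in \<open>auto simp: abs_less_iff intro: DERIV_cmult\<close>)
      then show "((\<lambda>s. arccos (c * f s)) has_derivative (\<lambda>h. D s * h)) (at s within {0..1})"
        by (simp add: has_field_derivative_def)
    qed simp
    then obtain t where "t \<in> {0<..<1}" and Dt: "arccos (c * f 1) - arccos (c * f 0) = D t"
      by auto
    then have t: "t \<in> {0..1}" by simp
    have pos: "sqrt (1 - (c * f t)\<^sup>2) > 0"
      using cf[OF t] by (simp add: abs_square_less_1)
    have "c * \<bar>w 0 \<bullet> w' t\<bar> \<le> 1 * (\<mu> * sqrt (1 - (f t)\<^sup>2))"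
      using f'_bound[OF t] c by (intro mult_mono) auto
    also have "\<dots> \<le> \<mu> * sqrt (1 - (c * f t)\<^sup>2)"
    proof -
      have "(c * f t)\<^sup>2 \<le> 1 * (f t)\<^sup>2"
        unfolding power_mult_distrib using c by (intro mult_right_mono) (auto simp: power_le_one)
      then show ?thesis using \<mu> by (auto intro!: mult_left_mono)
    qed
    finally have "\<bar>D t\<bar> \<le> \<mu>"
      using pos c by (simp add: D_def abs_mult divide_inverse[symmetric] field_simps)
    moreover have "f 0 = 1" using unit[of 0] by (simp add: f_def dot_square_norm)
    ultimately show ?thesis using Dt by auto
  qed
  have ev: "\<forall>\<^sub>F c in at_left 1. 0 < c \<and> c < (1::real)"
    unfolding eventually_at_left_field by (intro exI[of _ 0]) auto
  have lim: "((\<lambda>c. arccos (c * x)) \<longlongrightarrow> arccos (1 * x)) (at_left 1)" if "\<bar>x\<bar> \<le> 1" for x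
  proof -
    have "continuous_on {0..1} (\<lambda>c. arccos (c * x))"
      using that by (intro continuous_on_arccos continuous_intros)
        (auto simp: abs_le_iff, (smt (verit) mult_left_le mult_minus_right)+)
    then have "((\<lambda>c. arccos (c * x)) \<longlongrightarrow> arccos (1 * x)) (at 1 within {0..1})"
      unfolding continuous_on_def by (rule bspec) simp
    then show ?thesis
      by (simp add: at_within_Icc_at_left)
  qed
  have "arccos (1 * f 1) \<le> arccos (1 * 1) + \<mu>"
  proof (rule tendsto_le[OF _ _ lim])
    show "((\<lambda>c. arccos (c * 1) + \<mu>) \<longlongrightarrow> arccos (1 * 1) + \<mu>) (at_left 1)"
      by (intro tendsto_add lim tendsto_const) auto
    show "\<forall>\<^sub>F c in at_left 1. arccos (c * f 1) \<le> arccos (c * 1) + \<mu>"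
      using ev by eventually_elim (use main in auto)
  qed (use f_le in auto)
  then have "cos \<mu> \<le> cos (arccos (f 1))"
    using \<open>\<mu> \<le> pi\<close> \<mu> f_le[of 1] by (subst cos_mono_le_eq) (auto intro: arccos_lbound arccos_ubound simp: abs_le_iff)
  then show ?thesis using f_le[of 1] by (simp add: f_def abs_le_iff)
qed

text \<open>Writing \<open>x = 2 * sin \<theta>\<close>, the argument of the sine is
  \<open>2 * tan \<theta>\<close>, somewhat more than the angle \<open>2 * \<theta>\<close> of a
  unit circular arc over a chord of length \<open>x\<close>. With
  \<open>\<eta> = tan \<theta>\<close> one has
  \<open>x = 2 * \<eta> / sqrt (1 + \<eta>\<^sup>2)\<close>; the factors of
  \<open>sin (2 * \<eta>) = 2 * sin \<eta> * cos \<eta>\<close> obey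
  \<open>sin \<eta> \<le> \<eta>\<close> and, because \<open>\<eta> \<le> tan \<eta>\<close>, also
  \<open>cos \<eta> \<le> 1 / sqrt (1 + \<eta>\<^sup>2)\<close>.\<close>

lemma sin_arc_le:
  assumes "0 \<le> x" "x \<le> 1"
  shows "x / sqrt (1 - x\<^sup>2 / 4) \<le> pi / 2" "sin (x / sqrt (1 - x\<^sup>2 / 4)) \<le> x"
proof -
  define \<eta> where "\<eta> = x / sqrt (1 - x\<^sup>2 / 4) / 2"
  have x2: "x\<^sup>2 \<le> 1" using assms by (simp add: power_le_one)
  then have pos: "1 - x\<^sup>2 / 4 > 0" by simp
  have \<eta>0: "0 \<le> \<eta>" using assms pos by (simp add: \<eta>_def)
  have "(2 * \<eta>)\<^sup>2 = x\<^sup>2 / (1 - x\<^sup>2 / 4)"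
    using pos by (simp add: \<eta>_def power_divide)
  then have eq: "4 * \<eta>\<^sup>2 = x\<^sup>2 * (1 + \<eta>\<^sup>2)"
    using pos by (simp add: field_simps power2_eq_square)
  have "4 * \<eta>\<^sup>2 \<le> 1 + \<eta>\<^sup>2" unfolding eq using x2 by (simp add: mult_left_le_one_le)
  \<comment> \<open>The preceding line gives \<open>\<eta>\<^sup>2 \<le> 1 / 3\<close>; the cruder
    value 3/4 is still below \<open>pi / 4\<close>, as \<open>pi > 3\<close>.\<close>
  then have "\<eta>\<^sup>2 \<le> (3/4)\<^sup>2" by (simp add: power_divide)
  then have "\<eta> \<le> 3/4" by (rule power2_le_imp_le) simp
  then have lt: "\<eta> \<le> pi / 4" "\<eta> < pi / 2" using pi_gt3 by auto
  show "x / sqrt (1 - x\<^sup>2 / 4) \<le> pi / 2" using lt by (simp add: \<eta>_def mult.commute)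
  have c0: "cos \<eta> > 0" using lt \<eta>0 by (intro cos_gt_zero_pi) auto
  have "\<eta> \<le> tan \<eta>"
    using lt \<eta>0 arctan_le_self[of "tan \<eta>"] tan_pos_pi2_le[of \<eta>] by (simp add: arctan_tan)
  then have "\<eta> * cos \<eta> \<le> sin \<eta>" using c0 by (simp add: tan_def field_simps)
  then have "(\<eta> * cos \<eta>)\<^sup>2 \<le> (sin \<eta>)\<^sup>2" using \<eta>0 c0 by (intro power_mono) auto
  then have 1: "(cos \<eta>)\<^sup>2 * (1 + \<eta>\<^sup>2) \<le> 1"
    using sin_cos_squared_add[of \<eta>] by (simp only: power_mult_distrib distrib_left mult_1_right mult.commute)
  have "(sin \<eta>)\<^sup>2 \<le> \<eta>\<^sup>2"
    using \<eta>0 lt by (intro power_mono sin_x_le_x sin_ge_zero) auto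
  then have "4 * (sin \<eta>)\<^sup>2 * ((cos \<eta>)\<^sup>2 * (1 + \<eta>\<^sup>2)) \<le> 4 * \<eta>\<^sup>2 * 1"
    using 1 by (intro mult_mono) auto
  then have "(sin (2 * \<eta>))\<^sup>2 * (1 + \<eta>\<^sup>2) \<le> x\<^sup>2 * (1 + \<eta>\<^sup>2)"
    unfolding sin_double by (simp add: eq power_mult_distrib algebra_simps)
  then have "(sin (2 * \<eta>))\<^sup>2 \<le> x\<^sup>2"
    using mult_le_cancel_right_pos[of "1 + \<eta>\<^sup>2"] by (metis add_pos_nonneg zero_le_power2 zero_less_one)
  then have "sin (2 * \<eta>) \<le> x" using assms(1) by (rule power2_le_imp_le)
  then show "sin (x / sqrt (1 - x\<^sup>2 / 4)) \<le> x" by (simp add: \<eta>_def)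
qed

subsection \<open>Slice charts\<close>

lemma Ck_on_cong:
  assumes "open S" "\<And>x. x \<in> S \<Longrightarrow> f x = g x" "Ck_on n S f"
  shows "Ck_on n S g"
  using assms(2,3)
proof (induction n arbitrary: f g)
  case 0
  then show ?case by (auto cong: continuous_on_cong)
next
  case (Suc n)
  have f: "f differentiable (at x)" if "x \<in> S" for x
    using Suc.prems(2) that by simp
  have eq: "frechet_derivative f (at x) = frechet_derivative g (at x)" if "x \<in> S" for x
    using frechet_derivative_transform_within_open[OF f[OF that] \<open>open S\<close> that] Suc.prems(1) by blast
  have "g differentiable (at x)" if "x \<in> S" for x
    using f[OF that] Suc.prems(1) \<open>open S\<close> that
    by (meson differentiable_def has_derivative_transform_within_open)
  moreover have "Ck_on n S (\<lambda>x. frechet_derivative g (at x) h)" for h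
    by (rule Suc.IH[of "\<lambda>x. frechet_derivative f (at x) h"]) (use eq Suc.prems(2) in auto)
  ultimately show ?case by simp
qed

text \<open>This serves for straight lines in a chart, which \<open>\<psi>\<close> carries to the
  curves realising tangent vectors. For an affine inner map the directional derivative is again a
  function of the same form, with the constant direction \<open>A h\<close>, so the induction
  closes.\<close>

lemma Ck_on_compose_affine:
  fixes f :: "'a::euclidean_space \<Rightarrow> 'b::euclidean_space" and A :: "'c::euclidean_space \<Rightarrow> 'a"
  assumes "open T" "bounded_linear A" "\<And>x. x \<in> T \<Longrightarrow> a + A x \<in> S" "Ck_on n S f"
  shows "Ck_on n T (\<lambda>x. f (a + A x))"
  using assms(4)
proof (induction n arbitrary: f)
  case 0
  have "continuous_on T (\<lambda>x. a + A x)"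
    by (intro continuous_intros linear_continuous_on assms(2))
  then show ?case
    using 0 assms(3) by (auto intro: continuous_on_compose2[of S f])
next
  case (Suc n)
  have D: "((\<lambda>x. f (a + A x)) has_derivative (\<lambda>h. frechet_derivative f (at (a + A x)) (A h))) (at x)"
    if "x \<in> T" for x
  proof (rule has_derivative_compose[where f="\<lambda>x. a + A x"])
    show "((\<lambda>x. a + A x) has_derivative A) (at x)"
      using bounded_linear.has_derivative[OF assms(2) has_derivative_ident]
      by (auto intro!: derivative_eq_intros)
    show "(f has_derivative frechet_derivative f (at (a + A x))) (at (a + A x))"
      using Suc.prems assms(3)[OF that] by (simp add: frechet_derivative_works)
  qed
  have "Ck_on n T (\<lambda>x. frechet_derivative (\<lambda>x. f (a + A x)) (at x) h)" for h
  proof (rule Ck_on_cong[OF assms(1)])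
    show "Ck_on n T (\<lambda>x. frechet_derivative f (at (a + A x)) (A h))"
      by (rule Suc.IH) (use Suc.prems in simp)
  qed (use frechet_derivative_at[OF D] in metis)
  then show ?case using D by (auto intro: differentiableI)
qed

lemma closest_point_subspace_eqI:
  fixes S :: "'a::euclidean_space set"
  assumes "subspace S" "z \<in> S" "\<And>w. w \<in> S \<Longrightarrow> (u - z) \<bullet> w = 0"
  shows "closest_point S u = z"
proof (rule closest_point_unique[symmetric])
  show "\<forall>y\<in>S. dist u z \<le> dist u y"
  proof
    fix y assume "y \<in> S"
    then have "(u - z) \<bullet> (z - y) = 0"
      using assms by (simp add: subspace_diff)
    then have "(norm (u - y))\<^sup>2 = (norm (u - z))\<^sup>2 + (norm (z - y))\<^sup>2"
      using norm_add_Pythagorean[of "u - z" "z - y"] by (simp add: orthogonal_def)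
    then show "dist u z \<le> dist u y"
      unfolding dist_norm by (intro power2_le_imp_le[OF _ norm_ge_zero]) (simp only: le_add_same_cancel1 zero_le_power2)
  qed
qed (use assms in \<open>auto simp: subspace_imp_convex closed_subspace\<close>)

lemma closest_point_subspace_orthogonal:
  fixes S :: "'a::euclidean_space set"
  assumes "subspace S" "w \<in> S"
  shows "(u - closest_point S u) \<bullet> w = 0"
proof -
  obtain y z where yz: "y \<in> span S" "\<And>w. w \<in> span S \<Longrightarrow> orthogonal z w" "u = y + z"
    using orthogonal_subspace_decomp_exists[of S u] by blast
  then have "closest_point S u = y"
    using assms(1) by (intro closest_point_subspace_eqI) (auto simp: orthogonal_def subspace_span span_eq_iff[THEN iffD2])
  then show ?thesis
    using yz(2)[of w] assms by (simp add: yz(3) orthogonal_def span_base)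
qed

locale slice_chart =
  fixes M U W :: "'a::euclidean_space set" and \<phi> \<psi> :: "'a \<Rightarrow> 'a" and L :: "'a set"
  assumes open_U: "open U" and open_W: "open W"
    and homeo: "homeomorphism U W \<phi> \<psi>"
    and smooth_phi: "smooth_on U \<phi>" and smooth_psi: "smooth_on W \<psi>"
    and subspace_L: "subspace L" and slice: "\<phi> ` (U \<inter> M) = W \<inter> L"
begin

definition J :: "'a \<Rightarrow> 'a \<Rightarrow> 'a" where
  "J y = frechet_derivative \<psi> (at y)"

text \<open>The second derivative of the parametrisation \<open>\<psi>\<close>; for
  \<open>y\<close>, \<open>e\<close> and \<open>h\<close> in \<open>L\<close> its normal component
  is the second fundamental form of the tangent vectors \<open>J y e\<close> and
  \<open>J y h\<close>.\<close>

definition D2 :: "'a \<Rightarrow> 'a \<Rightarrow> 'a \<Rightarrow> 'a" where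
  "D2 y e h = frechet_derivative (\<lambda>x. J x h) (at y) e"

lemma psi_phi: "p \<in> U \<Longrightarrow> \<psi> (\<phi> p) = p" and phi_psi: "y \<in> W \<Longrightarrow> \<phi> (\<psi> y) = y"
  using homeo by (auto simp: homeomorphism_def)

lemma psi_in_U: "y \<in> W \<Longrightarrow> \<psi> y \<in> U" and phi_in_W: "p \<in> U \<Longrightarrow> \<phi> p \<in> W"
  using homeo by (auto simp: homeomorphism_def)

lemma phi_in_L: "p \<in> U \<Longrightarrow> p \<in> M \<Longrightarrow> \<phi> p \<in> L"
  using slice by blast

lemma psi_in_M: "y \<in> W \<Longrightarrow> y \<in> L \<Longrightarrow> \<psi> y \<in> M"
  using slice psi_phi by (metis (no_types, lifting) IntE IntI imageE)

lemma J_derivative: "y \<in> W \<Longrightarrow> (\<psi> has_derivative J y) (at y)"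
  using smooth_psi[unfolded smooth_on_def, rule_format, of 1]
  by (simp add: J_def frechet_derivative_works)

lemma D2_derivative: "y \<in> W \<Longrightarrow> ((\<lambda>x. J x h) has_derivative (\<lambda>e. D2 y e h)) (at y)"
  using smooth_psi[unfolded smooth_on_def, rule_format, of "Suc (Suc 0)"]
  by (simp add: J_def D2_def frechet_derivative_works[symmetric] eta_contract_eq)

lemma phi_derivative: "p \<in> U \<Longrightarrow> (\<phi> has_derivative frechet_derivative \<phi> (at p)) (at p)"
  using smooth_phi[unfolded smooth_on_def, rule_format, of 1]
  by (simp add: frechet_derivative_works)

lemma linear_J: "y \<in> W \<Longrightarrow> linear (J y)"
  using J_derivative has_derivative_linear by blast

lemma linear_D2: "y \<in> W \<Longrightarrow> linear (\<lambda>e. D2 y e h)"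
  using D2_derivative has_derivative_linear by blast

lemma J_eq_0_iff:
  assumes "y \<in> W" shows "J y h = 0 \<longleftrightarrow> h = 0"
proof
  assume "J y h = 0"
  let ?F = "frechet_derivative \<phi> (at (\<psi> y))"
  have F: "(\<phi> has_derivative ?F) (at (\<psi> y))"
    by (intro phi_derivative psi_in_U assms)
  have "((\<lambda>x. \<phi> (\<psi> x)) has_derivative (\<lambda>h. ?F (J y h))) (at y)"
    by (rule has_derivative_compose[OF J_derivative[OF assms] F])
  moreover have "((\<lambda>x. \<phi> (\<psi> x)) has_derivative (\<lambda>h. h)) (at y)"
    by (rule has_derivative_transform_within_open[OF has_derivative_ident open_W assms]) (simp add: phi_psi)
  ultimately have "?F (J y h) = h"
    by (metis has_derivative_unique)
  then show "h = 0"
    using \<open>J y h = 0\<close> has_derivative_linear[OF F] by (simp add: linear_0)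
qed (use linear_0[OF linear_J[OF assms]] in simp)

lemma inj_J: "y \<in> W \<Longrightarrow> inj (J y)"
  using linear_injective_0[OF linear_J] J_eq_0_iff by blast

lemma D2_symmetric:
  assumes "y \<in> W" shows "D2 y e h = D2 y h e"
proof -
  have "D2 y e h \<bullet> b = D2 y h e \<bullet> b" for b
  proof (rule second_derivative_symmetric[OF open_W assms, where f="\<lambda>x. \<psi> x \<bullet> b" and f'="\<lambda>x h. J x h \<bullet> b"
        and a=h and b=e and A="\<lambda>k. D2 y k h \<bullet> b" and B="\<lambda>k. D2 y k e \<bullet> b"])
    show "((\<lambda>x. \<psi> x \<bullet> b) has_derivative (\<lambda>h. J x h \<bullet> b)) (at x)" if "x \<in> W" for x
      by (rule has_derivative_inner_left[OF J_derivative[OF that]])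
  qed (rule has_derivative_inner_left[OF D2_derivative[OF assms]])+
  then show ?thesis by (metis inner_diff_left inner_eq_zero_iff right_minus_eq)
qed

lemma linear_D2_right: "y \<in> W \<Longrightarrow> linear (D2 y e)"
  using linear_D2[of y e] by (simp add: D2_symmetric[of y _ e] eta_contract_eq)

text \<open>Read in the chart, the curve stays in \<open>L\<close> near \<open>s\<close>. Its
  pairing with any vector orthogonal to \<open>L\<close> is therefore constantly zero, so the
  velocity lies in the double complement of \<open>L\<close>, which is \<open>L\<close>.\<close>

lemma curve_derivative_in_chart:
  fixes c :: "real \<Rightarrow> 'a"
  assumes c: "(c has_vector_derivative w) (at s)" and cM: "\<forall>\<^sub>F t in nhds s. c t \<in> M"
    and cs: "c s = \<psi> y" and y: "y \<in> W"
  shows "\<exists>e\<in>L. ((\<lambda>t. \<phi> (c t)) has_vector_derivative e) (at s) \<and> J y e = w"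
proof -
  have csU: "c s \<in> U" and phics: "\<phi> (c s) = y" using cs y psi_in_U phi_psi by auto
  define e where "e = frechet_derivative \<phi> (at (c s)) w"
  have e: "((\<lambda>t. \<phi> (c t)) has_vector_derivative e) (at s)"
    using has_derivative_compose[OF c[unfolded has_vector_derivative_def] phi_derivative[OF csU]]
      linear_scale[OF has_derivative_linear[OF phi_derivative[OF csU]]]
    by (simp add: has_vector_derivative_def e_def)
  have "isCont c s" using c has_vector_derivative_continuous by blast
  then have "\<forall>\<^sub>F t in nhds s. c t \<in> U"
    using open_U csU unfolding isCont_def eventually_nhds_conv_at by (auto dest: topological_tendstoD)
  then have "\<forall>\<^sub>F t in nhds s. c t \<in> U \<inter> M" using cM by eventually_elim auto
  then obtain T where T: "open T" "s \<in> T" "\<And>t. t \<in> T \<Longrightarrow> c t \<in> U \<inter> M"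
    unfolding eventually_nhds by blast
  have "((\<lambda>t. \<psi> (\<phi> (c t))) has_vector_derivative J y e) (at s)"
    using has_derivative_compose[OF e[unfolded has_vector_derivative_def], of \<psi> "J y"] J_derivative[OF y] phics
      linear_scale[OF linear_J[OF y]]
    by (simp add: has_vector_derivative_def)
  moreover have "((\<lambda>t. \<psi> (\<phi> (c t))) has_vector_derivative w) (at s)"
    by (rule has_vector_derivative_transform_within_open[OF c T(1,2)]) (use T(3) in \<open>simp add: psi_phi\<close>)
  ultimately have "J y e = w" by (rule vector_derivative_unique_at)
  moreover have "e \<in> L"
  proof -
    have "n \<bullet> e = 0" if n: "n \<in> L\<^sup>\<bottom>" for n
    proof -
      have "((\<lambda>t. n \<bullet> \<phi> (c t)) has_vector_derivative n \<bullet> e) (at s)"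
        by (rule bounded_linear.has_vector_derivative[OF bounded_linear_inner_right e])
      moreover have "((\<lambda>t. n \<bullet> \<phi> (c t)) has_vector_derivative 0) (at s)"
      proof (rule has_vector_derivative_transform_within_open[where f="\<lambda>_. 0", OF _ T(1,2)])
        fix t assume "t \<in> T"
        then have "\<phi> (c t) \<in> L" using T(3) phi_in_L by blast
        then show "0 = n \<bullet> \<phi> (c t)"
          using n by (simp add: orthogonal_comp_def orthogonal_def inner_commute[of n])
      qed simp
      ultimately show ?thesis by (rule vector_derivative_unique_at)
    qed
    then have "e \<in> L\<^sup>\<bottom>\<^sup>\<bottom>" by (auto simp: orthogonal_comp_def orthogonal_def)
    then show ?thesis using orthogonal_comp_self[OF subspace_L] by simp
  qed
  ultimately show ?thesis using e by blast
qed

text \<open>Curves in \<open>M\<close> have chart velocities in \<open>L\<close>, and conversely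
  \<open>\<psi>\<close> maps the line through \<open>y\<close> in a direction of \<open>L\<close> to
  a curve in \<open>M\<close>. This also shows that the set of velocities is a linear
  subspace.\<close>

lemma tangent_space_eq:
  assumes y: "y \<in> W" "y \<in> L"
  shows "tangent_space_at M (\<psi> y) = J y ` L"
proof (intro equalityI subsetI)
  fix w assume "w \<in> tangent_space_at M (\<psi> y)"
  then obtain c d where c: "0 < d" "c ` {-d<..<d} \<subseteq> M" "c 0 = \<psi> y" "(c has_vector_derivative w) (at 0)"
    unfolding tangent_space_at_def by blast
  have "\<forall>\<^sub>F t in nhds (0::real). t \<in> {-d<..<d}"
    using c(1) by (intro eventually_nhds_in_open) auto
  then have "\<forall>\<^sub>F t in nhds 0. c t \<in> M" by (rule eventually_mono) (use c(2) in blast)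
  then show "w \<in> J y ` L"
    using curve_derivative_in_chart[OF c(4) _ c(3) y(1)] by blast
next
  fix w assume "w \<in> J y ` L"
  then obtain e where e: "e \<in> L" "w = J y e" by blast
  obtain \<rho> where \<rho>: "\<rho> > 0" "ball y \<rho> \<subseteq> W" using open_W y(1) openE by blast
  \<comment> \<open>The summand 1 covers the constant curve \<open>e = 0\<close>.\<close>
  define d where "d = \<rho> / (norm e + 1)"
  have d: "d > 0" using \<rho> by (simp add: d_def add_nonneg_pos)
  have inW: "y + s *\<^sub>R e \<in> W" if "s \<in> {-d<..<d}" for s
  proof -
    have ne: "norm e + 1 > 0" by (rule add_nonneg_pos) auto
    have "\<bar>s\<bar> * norm e \<le> \<bar>s\<bar> * (norm e + 1)" by (rule mult_left_mono) auto
    also have "\<dots> < d * (norm e + 1)" using that ne by (intro mult_strict_right_mono) auto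
    also have "\<dots> = \<rho>" using ne by (simp add: d_def)
    finally have "y + s *\<^sub>R e \<in> ball y \<rho>" by (simp add: dist_norm)
    then show ?thesis using \<rho>(2) by blast
  qed
  have "((\<lambda>s. \<psi> (y + s *\<^sub>R e)) has_derivative (\<lambda>h. J y (h *\<^sub>R e))) (at 0)"
    by (rule has_derivative_compose[where f="\<lambda>s. y + s *\<^sub>R e"]) (use J_derivative[OF y(1)] in \<open>auto intro!: derivative_eq_intros\<close>)
  then have "((\<lambda>s. \<psi> (y + s *\<^sub>R e)) has_vector_derivative w) (at 0)"
    by (simp add: has_vector_derivative_def e(2) linear_scale[OF linear_J[OF y(1)]])
  moreover have "smooth_on {-d<..<d} (\<lambda>s. \<psi> (y + s *\<^sub>R e))"
    unfolding smooth_on_def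
    by (intro allI Ck_on_compose_affine[where S=W]) (use smooth_psi inW in \<open>auto simp: smooth_on_def bounded_linear_scaleR_left\<close>)
  moreover have "(\<lambda>s. \<psi> (y + s *\<^sub>R e)) ` {-d<..<d} \<subseteq> M"
    using inW psi_in_M subspace_L y e by (auto simp: subspace_add subspace_scale)
  ultimately show "w \<in> tangent_space_at M (\<psi> y)"
    unfolding tangent_space_at_def using d by (intro CollectI exI[of _ "\<lambda>s. \<psi> (y + s *\<^sub>R e)"] exI[of _ d]) auto
qed

lemma subspace_tangent: "y \<in> W \<Longrightarrow> subspace (J y ` L)"
  using linear_subspace_image linear_J subspace_L by blast

lemma normal_space_iff:
  "y \<in> W \<Longrightarrow> y \<in> L \<Longrightarrow> n \<in> normal_space_at M (\<psi> y) \<longleftrightarrow> (\<forall>e\<in>L. n \<bullet> J y e = 0)"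
  by (auto simp: normal_space_at_def tangent_space_eq orthogonal_comp_def orthogonal_def inner_commute)

end

subsection \<open>Balls tangent to the submanifold\<close>

text \<open>Along any curve in \<open>M\<close> through the closest point the squared distance to
  \<open>x\<close> is minimal there, so its derivative vanishes.\<close>

lemma closest_point_residual_normal:
  fixes M :: "'a::euclidean_space set"
  assumes "closed M" "M \<noteq> {}"
  shows "x - closest_point M x \<in> normal_space_at M (closest_point M x)"
proof -
  let ?p = "closest_point M x"
  have "(x - ?p) \<bullet> w = 0" if w: "w \<in> tangent_space_at M ?p" for w
  proof -
    obtain c d where c: "0 < d" "c ` {-d<..<d} \<subseteq> M" "c 0 = ?p" "(c has_vector_derivative w) (at (0::real))"
      using w unfolding tangent_space_at_def by blast
    have D: "((\<lambda>s. (x - c s) \<bullet> (x - c s)) has_derivative (\<lambda>h. h * (- 2 * ((x - ?p) \<bullet> w)))) (at 0)"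
      using c(4) unfolding has_vector_derivative_def
      by (auto intro!: derivative_eq_intros simp: c(3) inner_commute algebra_simps)
    moreover have "\<forall>\<^sub>F s in at 0. (x - c 0) \<bullet> (x - c 0) \<le> (x - c s) \<bullet> (x - c s)"
      unfolding eventually_at
    proof (intro exI[of _ d] conjI ballI impI)
      fix s :: real assume "s \<noteq> 0 \<and> dist s 0 < d"
      then have "c s \<in> M" using c(2) by (auto simp: dist_real_def abs_less_iff)
      then have "norm (x - ?p) \<le> norm (x - c s)"
        using closest_point_le[OF assms(1), of "c s" x] by (simp add: dist_norm)
      then show "(x - c 0) \<bullet> (x - c 0) \<le> (x - c s) \<bullet> (x - c s)"
        by (simp add: c(3) norm_le)
    qed (use c(1) in auto)
    ultimately have "(\<lambda>h. h * (- 2 * ((x - ?p) \<bullet> w))) = (\<lambda>h. 0)"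
      by (rule has_derivative_local_min)
    from fun_cong[OF this, of 1] show ?thesis by simp
  qed
  then show ?thesis
    by (auto simp: normal_space_at_def orthogonal_comp_def orthogonal_def inner_commute)
qed

text \<open>For \<open>u \<noteq> 0\<close> the inequality places \<open>q\<close> outside the open
  ball of radius \<open>r\<close> that touches \<open>M\<close> at \<open>p\<close> on the side of
  \<open>u\<close>. It is multiplied out by \<open>norm u\<close>, so that \<open>u\<close> need not
  be normalised and may be 0.\<close>

locale reach_bound =
  fixes M :: "'a::euclidean_space set" and r :: real
  assumes compact_M: "compact M" and r_pos: "0 < r"
    and ball_bound: "\<lbrakk>p \<in> M; q \<in> M; u \<in> normal_space_at M p\<rbrakk>
      \<Longrightarrow> 2 * r * (u \<bullet> (q - p)) \<le> norm u * (norm (q - p))\<^sup>2"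
begin

lemma closest_point_in: "p \<in> M \<Longrightarrow> closest_point M x \<in> M"
  using closest_point_in_set compact_imp_closed[OF compact_M] by blast

lemma residual_normal: "p \<in> M \<Longrightarrow> x - closest_point M x \<in> normal_space_at M (closest_point M x)"
  using closest_point_residual_normal compact_imp_closed[OF compact_M] by blast

lemma normal_space_neg: "u \<in> normal_space_at M p \<Longrightarrow> - u \<in> normal_space_at M p"
  unfolding normal_space_at_def by (rule subspace_neg[OF subspace_orthogonal_comp])

text \<open>The ball bounds at \<open>p\<close> and at the closest point, each with its own normal
  vector, are added along the segment joining the two points. For \<open>x = p + v\<close> the right
  side vanishes, which identifies the closest point; for \<open>x\<close> near \<open>p + v\<close>
  the inequality gives continuity.\<close>

lemma closest_point_lipschitz_at:
  assumes "p \<in> M" "v \<in> normal_space_at M p"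
  shows "(2 * r - norm v - norm (x - closest_point M x)) * norm (closest_point M x - p) \<le> 2 * r * norm (x - (p + v))"
proof -
  define q w where "q = closest_point M x" and "w = x - closest_point M x"
  have q: "q \<in> M" "w \<in> normal_space_at M q"
    using closest_point_in residual_normal assms(1) by (auto simp: q_def w_def)
  have "2 * r * (v \<bullet> (q - p)) \<le> norm v * (norm (q - p))\<^sup>2"
    by (rule ball_bound[OF assms(1) q(1) assms(2)])
  moreover have "2 * r * (w \<bullet> (p - q)) \<le> norm w * (norm (q - p))\<^sup>2"
    using ball_bound[OF q(1) assms(1) q(2)] by (simp add: norm_minus_commute)
  moreover have "(x - (p + v)) \<bullet> (q - p) = (norm (q - p))\<^sup>2 - w \<bullet> (p - q) - v \<bullet> (q - p)"
    unfolding power2_norm_eq_inner q_def w_def by (simp add: inner_diff_left inner_diff_right inner_add_left algebra_simps)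
  ultimately have "(2 * r - norm v - norm w) * (norm (q - p))\<^sup>2 \<le> 2 * r * ((x - (p + v)) \<bullet> (q - p))"
    by (simp only: left_diff_distrib right_diff_distrib)
  also have "\<dots> \<le> 2 * r * (norm (x - (p + v)) * norm (q - p))"
    using r_pos by (intro mult_left_mono norm_cauchy_schwarz) auto
  finally have "((2 * r - norm v - norm w) * norm (q - p)) * norm (q - p) \<le> (2 * r * norm (x - (p + v))) * norm (q - p)"
    by (simp add: power2_eq_square algebra_simps)
  then have "(2 * r - norm v - norm w) * norm (q - p) \<le> 2 * r * norm (x - (p + v))"
    using r_pos by (cases "q = p") (auto simp: mult_le_cancel_right)
  then show ?thesis unfolding q_def w_def .
qed

lemma closest_point_eq:
  assumes "p \<in> M" "v \<in> normal_space_at M p" "norm v < r"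
  shows "closest_point M (p + v) = p"
proof -
  let ?q = "closest_point M (p + v)"
  have "norm (p + v - ?q) \<le> norm v"
    using closest_point_le[OF compact_imp_closed[OF compact_M] assms(1), of "p + v"] by (simp add: dist_norm)
  then have "2 * r - norm v - norm (p + v - ?q) > 0" using assms(3) by simp
  moreover have "(2 * r - norm v - norm (p + v - ?q)) * norm (?q - p) \<le> 0"
    using closest_point_lipschitz_at[OF assms(1,2), of "p + v"] by simp
  ultimately have "norm (?q - p) \<le> 0" by (simp add: mult_le_0_iff)
  then show ?thesis by simp
qed

lemma closest_point_isCont:
  assumes "p \<in> M" "v \<in> normal_space_at M p" "norm v < r"
  shows "isCont (closest_point M) (p + v)"
proof -
  \<comment> \<open>For \<open>x\<close> within \<open>\<delta>\<close> of \<open>p + v\<close> the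
    residual stays below \<open>r\<close>, so the factor on the left of the Lipschitz estimate is at
    least \<open>\<delta>\<close>.\<close>
  define \<delta> where "\<delta> = r - norm v"
  have \<delta>: "\<delta> > 0" using assms(3) by (simp add: \<delta>_def)
  have "norm (closest_point M x - p) \<le> 2 * r / \<delta> * norm (x - (p + v))" if "norm (x - (p + v)) < \<delta>" for x
  proof -
    have "norm (x - closest_point M x) \<le> norm (x - p)"
      using closest_point_le[OF compact_imp_closed[OF compact_M] assms(1), of x] by (simp add: dist_norm)
    also have "\<dots> \<le> norm v + norm (x - (p + v))"
      using norm_triangle_ineq[of v "x - (p + v)"] by simp
    finally have "\<delta> \<le> 2 * r - norm v - norm (x - closest_point M x)"
      using that by (simp add: \<delta>_def)
    then have "\<delta> * norm (closest_point M x - p) \<le> 2 * r * norm (x - (p + v))"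
      using closest_point_lipschitz_at[OF assms(1,2), of x] by (meson mult_right_mono norm_ge_zero order_trans)
    then show ?thesis using \<delta> by (simp add: field_simps)
  qed
  then have "\<forall>\<^sub>F x in at (p + v). norm (closest_point M x - p) \<le> 2 * r / \<delta> * norm (x - (p + v))"
    unfolding eventually_at using \<delta> by (auto simp: dist_norm)
  moreover have "((\<lambda>x. 2 * r / \<delta> * norm (x - (p + v))) \<longlongrightarrow> 2 * r / \<delta> * norm ((p + v) - (p + v))) (at (p + v))"
    by (intro tendsto_intros)
  then have "((\<lambda>x. 2 * r / \<delta> * norm (x - (p + v))) \<longlongrightarrow> 0) (at (p + v))" by simp
  ultimately have "((\<lambda>x. closest_point M x - p) \<longlongrightarrow> 0) (at (p + v))"
    by (rule Lim_null_comparison)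
  then show ?thesis
    unfolding isCont_def closest_point_eq[OF assms] by (simp add: LIM_zero_iff)
qed

end

locale reach_chart = slice_chart M U W \<phi> \<psi> L + reach_bound M r
  for M U W :: "'a::euclidean_space set" and \<phi> \<psi> L r
begin

text \<open>\<open>g\<close> is the slack in the ball bound along a chart line through
  \<open>y\<close>. It is nonnegative and zero at 0, so its second derivative there is nonnegative;
  the term pairing \<open>\<psi> (?c s) - ?p\<close> with the second derivative of
  \<open>\<psi>\<close> drops out at 0.\<close>

lemma second_form_diag_le:
  assumes y: "y \<in> W" "y \<in> L" and u: "u \<in> normal_space_at M (\<psi> y)" and e: "e \<in> L"
  shows "r * (u \<bullet> D2 y e e) \<le> norm u * (norm (J y e))\<^sup>2"
proof -
  let ?p = "\<psi> y" and ?c = "\<lambda>s. y + s *\<^sub>R e"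
  define g where "g = (\<lambda>s. norm u * ((\<psi> (?c s) - ?p) \<bullet> (\<psi> (?c s) - ?p)) - 2 * r * (u \<bullet> (\<psi> (?c s) - ?p)))"
  define g' where "g' = (\<lambda>s. 2 * norm u * ((\<psi> (?c s) - ?p) \<bullet> J (?c s) e) - 2 * r * (u \<bullet> J (?c s) e))"
  have "open (?c -` W)" by (intro continuous_open_vimage open_W) (auto intro!: continuous_intros)
  moreover have "0 \<in> ?c -` W" using y by simp
  ultimately obtain d where d: "d > 0" "ball 0 d \<subseteq> ?c -` W" using openE by blast
  have inW: "?c s \<in> W" if "\<bar>s\<bar> < d" for s using d(2) that by (auto simp: dist_norm)
  have cD: "(?c has_derivative (\<lambda>h. h *\<^sub>R e)) (at s)" for s by (auto intro!: derivative_eq_intros)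
  have psiD: "((\<lambda>s. \<psi> (?c s)) has_derivative (\<lambda>h. h *\<^sub>R J (?c s) e)) (at s)" if "\<bar>s\<bar> < d" for s
    using has_derivative_compose[OF cD J_derivative[OF inW[OF that]]] linear_scale[OF linear_J[OF inW[OF that]]]
    by simp
  have JD: "((\<lambda>s. J (?c s) e) has_derivative (\<lambda>h. h *\<^sub>R D2 y e e)) (at 0)"
    using has_derivative_compose[OF cD[of 0], of "\<lambda>x. J x e" "\<lambda>k. D2 y k e"] D2_derivative[OF y(1), of e]
    by (simp add: linear_scale[OF linear_D2[OF y(1)]])
  have "0 \<le> 2 * norm u * (J y e \<bullet> J y e) - 2 * r * (u \<bullet> D2 y e e)"
  proof (rule second_derivative_nonneg_at_min[OF d(1)])
    show "(g has_real_derivative g' s) (at s)" if "\<bar>s\<bar> < d" for s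
      unfolding g_def g'_def has_field_derivative_def
      by (rule derivative_eq_intros psiD[OF that] refl)+ (simp add: fun_eq_iff inner_commute algebra_simps)
    show "(g' has_real_derivative 2 * norm u * (J y e \<bullet> J y e) - 2 * r * (u \<bullet> D2 y e e)) (at 0)"
      unfolding g'_def has_field_derivative_def
      by (rule derivative_eq_intros psiD JD d(1) refl | simp add: d(1))+ (simp add: fun_eq_iff inner_commute algebra_simps)
    show "g 0 \<le> g s" if "\<bar>s\<bar> < d" for s
    proof -
      have "\<psi> (?c s) \<in> M" using inW[OF that] psi_in_M y e subspace_L by (simp add: subspace_add subspace_scale)
      from ball_bound[OF psi_in_M[OF y] this u] show ?thesis
        by (simp add: g_def power2_norm_eq_inner)
    qed
  qed
  then show ?thesis by (simp add: power2_norm_eq_inner)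
qed

text \<open>The form is symmetric, so polarisation and the parallelogram law carry the diagonal
  bound over to pairs. Using the diagonal bound for both \<open>u\<close> and \<open>- u\<close>
  supplies the absolute value.\<close>

lemma second_form_le:
  assumes y: "y \<in> W" "y \<in> L" and u: "u \<in> normal_space_at M (\<psi> y)" and e: "e \<in> L" "e' \<in> L"
  shows "\<bar>u \<bullet> D2 y e e'\<bar> \<le> norm u * norm (J y e) * norm (J y e') / r"
proof (cases "e = 0 \<or> e' = 0")
  case True
  then show ?thesis
    using linear_0[OF linear_D2[OF y(1)]] linear_0[OF linear_D2_right[OF y(1)]] r_pos by auto
next
  case False
  define b where "b = (\<lambda>e e'. u \<bullet> D2 y e e')"
  have add1: "b (x + x') z = b x z + b x' z" and diff1: "b (x - x') z = b x z - b x' z" for x x' z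
    by (simp_all add: b_def linear_add[OF linear_D2[OF y(1)]] linear_diff[OF linear_D2[OF y(1)]] inner_add_right inner_diff_right)
  have add2: "b z (x + x') = b z x + b z x'" and diff2: "b z (x - x') = b z x - b z x'" for x x' z
    by (simp_all add: b_def linear_add[OF linear_D2_right[OF y(1)]] linear_diff[OF linear_D2_right[OF y(1)]] inner_add_right inner_diff_right)
  have sc: "b (s *\<^sub>R x) (t *\<^sub>R z) = s * t * b x z" for s t x z
    by (simp add: b_def linear_scale[OF linear_D2[OF y(1)]] linear_scale[OF linear_D2_right[OF y(1)]])
  have sym: "b x z = b z x" for x z by (simp add: b_def D2_symmetric[OF y(1)])
  have diag: "r * \<bar>b x x\<bar> \<le> norm u * (norm (J y x))\<^sup>2" if "x \<in> L" for x
    using second_form_diag_le[OF y u that] second_form_diag_le[OF y normal_space_neg[OF u] that]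
    by (simp add: b_def abs_if)
  have pol: "r * \<bar>b x z\<bar> \<le> norm u * ((norm (J y x))\<^sup>2 + (norm (J y z))\<^sup>2) / 2" if "x \<in> L" "z \<in> L" for x z
  proof -
    have "4 * b x z = b (x + z) (x + z) - b (x - z) (x - z)"
      using sym[of x z] by (simp add: add1 add2 diff1 diff2)
    then have "r * (4 * \<bar>b x z\<bar>) \<le> r * (\<bar>b (x + z) (x + z)\<bar> + \<bar>b (x - z) (x - z)\<bar>)"
      using r_pos by (intro mult_left_mono) auto
    also have "\<dots> \<le> norm u * (norm (J y (x + z)))\<^sup>2 + norm u * (norm (J y (x - z)))\<^sup>2"
      using diag[of "x + z"] diag[of "x - z"] subspace_add[OF subspace_L that] subspace_diff[OF subspace_L that]
      by (simp add: distrib_left)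
    also have "\<dots> = norm u * (2 * ((norm (J y x))\<^sup>2 + (norm (J y z))\<^sup>2))"
      unfolding distrib_left[symmetric] linear_add[OF linear_J[OF y(1)]] linear_diff[OF linear_J[OF y(1)]]
      by (simp add: power2_norm_eq_inner inner_add_left inner_add_right inner_diff_left inner_diff_right)
    finally show ?thesis by (simp add: algebra_simps)
  qed
  \<comment> \<open>Polarisation yields the mean of the squared norms rather than their product; the
    two agree once both tangent vectors are scaled to length 1.\<close>
  define a a' where "a = norm (J y e)" and "a' = norm (J y e')"
  have pos: "a > 0" "a' > 0" using False J_eq_0_iff[OF y(1)] by (auto simp: a_def a'_def)
  have unit: "norm (J y (e /\<^sub>R a)) = 1" "norm (J y (e' /\<^sub>R a')) = 1"
    using pos by (simp_all add: linear_scale[OF linear_J[OF y(1)]] a_def a'_def)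
  have "r * \<bar>b (e /\<^sub>R a) (e' /\<^sub>R a')\<bar> \<le> norm u"
    using pol[of "e /\<^sub>R a" "e' /\<^sub>R a'"] unit e subspace_L by (simp add: subspace_scale)
  moreover have "\<bar>b (e /\<^sub>R a) (e' /\<^sub>R a')\<bar> = \<bar>b e e'\<bar> / (a * a')"
    using pos by (simp add: sc abs_mult field_simps)
  ultimately have "r * (\<bar>b e e'\<bar> / (a * a')) \<le> norm u" by simp
  then have "r * \<bar>b e e'\<bar> \<le> norm u * (a * a')"
    using pos by (simp add: pos_divide_le_eq)
  then show ?thesis using r_pos by (simp add: b_def a_def a'_def field_simps)
qed

end

subsection \<open>The differential of the projection\<close>

context reach_chart
begin

lemma closest_point_derivative_in_chart:
  assumes y: "y \<in> W" "y \<in> L" and v: "v \<in> normal_space_at M (\<psi> y)" "norm v < r"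
  shows "\<exists>A. (closest_point M has_derivative A) (at (\<psi> y + v)) \<and>
           (\<forall>h. A h \<in> J y ` L \<and> (\<forall>t\<in>J y ` L. \<bar>(h - A h) \<bullet> t\<bar> \<le> norm v / r * norm (A h) * norm t))"
proof -
  let ?p = "\<psi> y" and ?x = "\<psi> y + v"
  have pM: "?p \<in> M" and pU: "?p \<in> U" using y psi_in_M psi_in_U by auto
  have cpx: "closest_point M ?x = ?p" by (rule closest_point_eq[OF pM v])
  obtain B where B: "B \<subseteq> L" "pairwise orthogonal B" "\<And>b. b \<in> B \<Longrightarrow> norm b = 1"
    "independent B" "span B = L"
    using orthonormal_basis_subspace[OF subspace_L] by metis
  have finB: "finite B" using B(4) by (rule independent_imp_finite)
  have coeff: "(\<Sum>b\<in>B. f b *\<^sub>R b) \<bullet> b' = f b'" if "b' \<in> B" for f :: "'a \<Rightarrow> real" and b'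
  proof -
    have "f b * (b \<bullet> b') = (if b = b' then f b' else 0)" if "b \<in> B" for b
      using B(2) B(3)[OF \<open>b' \<in> B\<close>] that \<open>b' \<in> B\<close> by (auto simp: pairwise_def orthogonal_def norm_eq_1)
    then have "(\<Sum>b\<in>B. f b *\<^sub>R b) \<bullet> b' = (\<Sum>b\<in>B. if b = b' then f b' else 0)"
      by (simp add: inner_sum_left)
    then show ?thesis using finB that by simp
  qed
  have expand: "(\<Sum>b\<in>B. (z \<bullet> b) *\<^sub>R b) = z" if "z \<in> L" for z
    using orthonormal_basis_expand[OF B(2,3) _ finB] B(5) that by simp
  text \<open>The chart coordinate of the closest point is a zero of \<open>G (x, _)\<close>; the second summand of
    \<open>G\<close> forces it into \<open>L\<close>, and the bound on the second fundamental form makes the partial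
    derivative of \<open>G\<close> in the coordinate injective.\<close>
  define G where "G = (\<lambda>xz. (\<Sum>b\<in>B. ((fst xz - \<psi> (snd xz)) \<bullet> J (snd xz) b) *\<^sub>R b)
    + (snd xz - (\<Sum>b\<in>B. (snd xz \<bullet> b) *\<^sub>R b)))"
  define D where "D = (\<lambda>hk. (\<Sum>b\<in>B. (v \<bullet> D2 y (snd hk) b + (fst hk - J y (snd hk)) \<bullet> J y b) *\<^sub>R b)
    + (snd hk - (\<Sum>b\<in>B. (snd hk \<bullet> b) *\<^sub>R b)))"
  define Y where "Y = (\<lambda>x. \<phi> (closest_point M x))"
  have Yx: "Y ?x = y" by (simp add: Y_def cpx phi_psi y)
  \<comment> \<open>The first part of \<open>D\<close> lies in \<open>L\<close> and the second is
    orthogonal to \<open>L\<close>, so both vanish. Linearity of \<open>c\<close> then passes from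
    the basis \<open>B\<close> to all of \<open>L\<close>.\<close>
  have D_zero: "k \<in> L \<and> (\<forall>e\<in>L. v \<bullet> D2 y k e + (h - J y k) \<bullet> J y e = 0)" if "D (h, k) = 0" for h k
  proof -
    define c where "c = (\<lambda>e. v \<bullet> D2 y k e + (h - J y k) \<bullet> J y e)"
    have eq: "(\<Sum>b\<in>B. c b *\<^sub>R b) + (k - (\<Sum>b\<in>B. (k \<bullet> b) *\<^sub>R b)) = 0"
      using that by (simp add: D_def c_def)
    have c0: "c b = 0" if "b \<in> B" for b
      using arg_cong[OF eq, of "\<lambda>z. z \<bullet> b"] coeff[OF that]
      by (simp add: inner_add_left inner_diff_left)
    then have k: "(\<Sum>b\<in>B. (k \<bullet> b) *\<^sub>R b) = k" using eq by simp
    have "(\<Sum>b\<in>B. (k \<bullet> b) *\<^sub>R b) \<in> span B" by (intro span_sum span_scale span_base)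
    then have "k \<in> L" unfolding k B(5) .
    moreover have "linear c"
      unfolding c_def
      by (rule linearI)
        (simp_all add: linear_add[OF linear_D2_right[OF y(1)]] linear_scale[OF linear_D2_right[OF y(1)]]
          linear_add[OF linear_J[OF y(1)]] linear_scale[OF linear_J[OF y(1)]] inner_add_right algebra_simps)
    then have "c e = 0" if "e \<in> L" for e
      using linear_eq_0_on_span[of c B e] c0 B(5) that by blast
    ultimately show ?thesis by (simp add: c_def)
  qed
  have "\<exists>Y'. (Y has_derivative Y') (at ?x) \<and> (\<forall>h. D (h, Y' h) = 0)"
  proof (rule has_derivative_implicit)
    have fstD: "(fst has_derivative fst) (at (?x, y))" and sndD: "(snd has_derivative snd) (at (?x, y))"
      by (auto intro!: derivative_eq_intros)
    have psiD: "((\<lambda>xz. \<psi> (snd xz)) has_derivative (\<lambda>hk. J y (snd hk))) (at (?x, y))"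
      using has_derivative_compose[OF sndD, of \<psi> "J y"] J_derivative[OF y(1)] by simp
    have JD: "((\<lambda>xz. J (snd xz) b) has_derivative (\<lambda>hk. D2 y (snd hk) b)) (at (?x, y))" for b
      using has_derivative_compose[OF sndD, of "\<lambda>z. J z b" "\<lambda>k. D2 y k b"] D2_derivative[OF y(1)] by simp
    have termD: "((\<lambda>xz. ((fst xz - \<psi> (snd xz)) \<bullet> J (snd xz) b) *\<^sub>R b) has_derivative
        (\<lambda>hk. (v \<bullet> D2 y (snd hk) b + (fst hk - J y (snd hk)) \<bullet> J y b) *\<^sub>R b)) (at (?x, y))" for b
      using has_derivative_scaleR_left[OF has_derivative_inner[OF has_derivative_diff[OF fstD psiD] JD[of b]], of b]
      by simp
    have term2D: "((\<lambda>xz. (snd xz \<bullet> b) *\<^sub>R b) has_derivative (\<lambda>hk. (snd hk \<bullet> b) *\<^sub>R b)) (at (?x, y))" for b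
      by (rule has_derivative_scaleR_left[OF has_derivative_inner_left[OF sndD]])
    have "(G has_derivative D) (at (?x, y))"
      unfolding G_def D_def
      by (intro has_derivative_add has_derivative_sum has_derivative_diff sndD termD term2D)
    then show "(G has_derivative D) (at (?x, Y ?x))" unfolding Yx .
  next
    fix k assume "D (0, k) = 0"
    from D_zero[OF this] have k: "k \<in> L" and "v \<bullet> D2 y k k + (0 - J y k) \<bullet> J y k = 0" by auto
    \<comment> \<open>Testing the kernel equation with \<open>e = k\<close> itself bounds
      \<open>(norm (J y k))\<^sup>2\<close> by \<open>norm v / r < 1\<close> times itself.\<close>
    then have "(norm (J y k))\<^sup>2 = v \<bullet> D2 y k k" by (simp add: power2_norm_eq_inner)
    also have "\<dots> \<le> norm v * norm (J y k) * norm (J y k) / r"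
      using second_form_le[OF y v(1) k k] by simp
    finally have "(r - norm v) * (norm (J y k))\<^sup>2 \<le> 0"
      using r_pos by (simp add: field_simps power2_eq_square)
    then have "J y k = 0" using v(2) by (simp add: mult_le_0_iff)
    then show "k = 0" using J_eq_0_iff[OF y(1)] by simp
  next
    have "isCont (closest_point M) ?x" by (rule closest_point_isCont[OF pM v])
    moreover have "isCont \<phi> (closest_point M ?x)"
      unfolding cpx using has_derivative_continuous[OF phi_derivative[OF pU]] .
    ultimately show "isCont Y ?x" unfolding Y_def by (rule isCont_o2)
  next
    have "\<forall>\<^sub>F x in nhds ?x. closest_point M x \<in> U"
      using closest_point_isCont[OF pM v] open_U pU cpx
      unfolding isCont_def eventually_nhds_conv_at by (auto dest: topological_tendstoD)
    then show "\<forall>\<^sub>F x in nhds ?x. G (x, Y x) = 0"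
    proof eventually_elim
      fix x assume x: "closest_point M x \<in> U"
      have qM: "closest_point M x \<in> M" using closest_point_in[OF pM] .
      have Yx: "\<psi> (Y x) = closest_point M x" "Y x \<in> W" "Y x \<in> L"
        using x qM by (auto simp: Y_def psi_phi phi_in_W phi_in_L)
      have "(x - \<psi> (Y x)) \<bullet> J (Y x) b = 0" if "b \<in> B" for b
        using residual_normal[OF pM, of x] normal_space_iff[OF Yx(2,3)] Yx(1) B(1) that by auto
      then show "G (x, Y x) = 0" by (simp add: G_def expand[OF Yx(3)])
    qed
  qed
  then obtain Y' where Y': "(Y has_derivative Y') (at ?x)" "\<And>h. D (h, Y' h) = 0" by blast
  have "\<forall>\<^sub>F x in nhds ?x. closest_point M x \<in> U"
    using closest_point_isCont[OF pM v] open_U pU cpx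
    unfolding isCont_def eventually_nhds_conv_at by (auto dest: topological_tendstoD)
  then obtain T where T: "open T" "?x \<in> T" "\<And>x. x \<in> T \<Longrightarrow> closest_point M x \<in> U"
    unfolding eventually_nhds by blast
  have "((\<lambda>x. \<psi> (Y x)) has_derivative (\<lambda>h. J y (Y' h))) (at ?x)"
    using has_derivative_compose[OF Y'(1), of \<psi> "J y"] J_derivative[OF y(1)] Yx by simp
  then have "(closest_point M has_derivative (\<lambda>h. J y (Y' h))) (at ?x)"
    by (rule has_derivative_transform_within_open[OF _ T(1,2)]) (use T(3) in \<open>simp add: Y_def psi_phi\<close>)
  moreover have "J y (Y' h) \<in> J y ` L" for h using D_zero[OF Y'(2)] by blast
  moreover have "\<bar>(h - J y (Y' h)) \<bullet> t\<bar> \<le> norm v / r * norm (J y (Y' h)) * norm t" if t: "t \<in> J y ` L" for h t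
  proof -
    obtain e where e: "e \<in> L" "t = J y e" using t by blast
    \<comment> \<open>The linearised equation says that the tangential part of
      \<open>h - J y (Y' h)\<close> is, up to sign, the second fundamental form paired with
      \<open>v\<close>.\<close>
    have "(h - J y (Y' h)) \<bullet> t = - (v \<bullet> D2 y (Y' h) e)"
      using D_zero[OF Y'(2), of h] e by (auto simp: eq_neg_iff_add_eq_0 add.commute)
    then show ?thesis
      using second_form_le[OF y v(1), of "Y' h" e] D_zero[OF Y'(2), of h] e by simp
  qed
  ultimately show ?thesis by blast
qed

section \<open>Tangential projections in a chart and their derivative\<close>

definition K :: "'a \<Rightarrow> 'a \<Rightarrow> 'a" where
  "K x u = closest_point (J x ` L) u"

lemma K_in: "x \<in> W \<Longrightarrow> K x u \<in> J x ` L"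
  unfolding K_def using subspace_tangent[of x] subspace_0[OF subspace_L] by (intro closest_point_in_set) (auto simp: closed_subspace subspace_0)

lemma K_orthogonal: "x \<in> W \<Longrightarrow> t \<in> J x ` L \<Longrightarrow> (u - K x u) \<bullet> t = 0"
  unfolding K_def using closest_point_subspace_orthogonal[OF subspace_tangent] .

lemma K_pythagoras:
  assumes "x \<in> W" shows "(norm (K x u))\<^sup>2 + (norm (u - K x u))\<^sup>2 = (norm u)\<^sup>2"
proof -
  have "orthogonal (K x u) (u - K x u)"
    using K_orthogonal[OF assms K_in[OF assms]] by (simp add: orthogonal_def inner_commute)
  from norm_add_Pythagorean[OF this] show ?thesis by simp
qed

lemma K_normal: "y \<in> W \<Longrightarrow> y \<in> L \<Longrightarrow> u - K y u \<in> normal_space_at M (\<psi> y)"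
  by (auto simp: normal_space_iff intro: K_orthogonal)

text \<open>\<open>K\<close> projects onto the image of \<open>L\<close> under \<open>J x\<close>
  for every \<open>x\<close> in the open set \<open>W\<close>, also off \<open>L\<close>, so it can
  be differentiated in the ambient space. The frame \<open>J x b\<close>, with \<open>b\<close> in a
  basis of \<open>L\<close>, is differentiable and independent, and Gram-Schmidt applies.\<close>

lemma K_differentiable:
  assumes "y \<in> W" shows "(\<lambda>x. K x u) differentiable (at y)"
proof -
  obtain B where B: "B \<subseteq> L" "independent B" "span B = L"
    by (metis basis_subspace_exists subspace_L)
  have "\<exists>q. q differentiable (at y) \<and>
      (\<forall>x. q x \<in> span ((\<lambda>b. J x b) ` B) \<and> (\<forall>b\<in>B. (u - q x) \<bullet> J x b = 0))"
  proof (rule differentiable_gram_schmidt[where c="\<lambda>b x. J x b" and f="\<lambda>_. u"])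
    show "finite B" using B(2) by (rule independent_imp_finite)
    show "(\<lambda>x. J x b) differentiable (at y)" for b
      using D2_derivative[OF assms] by (rule differentiableI)
    show "inj_on (\<lambda>b. J y b) B" using inj_J[OF assms] by (rule inj_on_subset) simp
    show "independent ((\<lambda>b. J y b) ` B)"
      using linear_independent_injective_image[OF linear_J[OF assms] B(2)] inj_J[OF assms]
      by (metis inj_on_subset subset_UNIV)
  qed simp
  then obtain q where q: "q differentiable (at y)" "\<And>x. q x \<in> span ((\<lambda>b. J x b) ` B)"
    "\<And>x b. b \<in> B \<Longrightarrow> (u - q x) \<bullet> J x b = 0"
    by blast
  have "K x u = q x" if x: "x \<in> W" for x
  proof -
    have sp: "span (J x ` B) = J x ` L" using linear_span_image[OF linear_J[OF x]] B(3) by metis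
    have "(u - q x) \<bullet> t = 0" if "t \<in> span (J x ` B)" for t
      using that by (induction rule: span_induct_alt) (use q(3) in \<open>auto simp: inner_add_right\<close>)
    then show ?thesis
      unfolding K_def using q(2)[of x] sp by (intro closest_point_subspace_eqI subspace_tangent x) auto
  qed
  then have "((\<lambda>x. K x u) has_derivative frechet_derivative q (at y)) (at y)"
    by (intro has_derivative_transform_within_open[OF q(1)[unfolded frechet_derivative_works] open_W assms]) simp
  then show ?thesis by (rule differentiableI)
qed

text \<open>Differentiating \<open>K x a \<bullet> K x b = K x a \<bullet> b\<close> shows that the
  derivative of a projection only mixes tangential with normal parts. Each of the two mixed terms is
  a value of the second fundamental form, and Cauchy-Schwarz recombines them without losing a
  factor.\<close>

lemma K_derivative_le:
  assumes y: "y \<in> W" "y \<in> L" and e: "e \<in> L"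
    and D: "\<And>u. ((\<lambda>x. K x u) has_derivative D u) (at y)"
  shows "norm (D a e) \<le> norm (J y e) / r * norm a"
proof -
  have prod: "D a e \<bullet> b = K y a \<bullet> D b e + D a e \<bullet> K y b" for a b
  proof -
    have "((\<lambda>x. K x a \<bullet> K x b) has_derivative (\<lambda>e. K y a \<bullet> D b e + D a e \<bullet> K y b)) (at y)"
      by (rule has_derivative_inner[OF D D])
    moreover have "((\<lambda>x. K x a \<bullet> K x b) has_derivative (\<lambda>e. D a e \<bullet> b)) (at y)"
    proof (rule has_derivative_transform_within_open[OF has_derivative_inner_left[OF D] open_W y(1)])
      show "K x a \<bullet> b = K x a \<bullet> K x b" if "x \<in> W" for x
        using K_orthogonal[OF that K_in[OF that], of b a] by (simp add: inner_diff_left inner_commute[of "K x a"])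
    qed
    ultimately have "(\<lambda>e. K y a \<bullet> D b e + D a e \<bullet> K y b) = (\<lambda>e. D a e \<bullet> b)"
      by (rule has_derivative_unique)
    from fun_cong[OF this, of e] show ?thesis by simp
  qed
  have half: "\<bar>K y b \<bullet> D a e\<bar> \<le> norm (J y e) / r * (norm (a - K y a) * norm (K y b))" for a b
  proof -
    obtain e' where e': "e' \<in> L" "K y b = J y e'" using K_in[OF y(1)] by blast
    \<comment> \<open>\<open>J x e'\<close> is in the range of \<open>K x\<close>, so pairing it
      with \<open>K x a\<close> or with \<open>a\<close> is the same; differentiating this identity
      trades the derivative of \<open>K\<close> for \<open>D2\<close>.\<close>
    have "((\<lambda>x. J x e' \<bullet> K x a) has_derivative (\<lambda>e. J y e' \<bullet> D a e + D2 y e e' \<bullet> K y a)) (at y)"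
      by (rule has_derivative_inner[OF D2_derivative[OF y(1)] D])
    moreover have "((\<lambda>x. J x e' \<bullet> K x a) has_derivative (\<lambda>e. D2 y e e' \<bullet> a)) (at y)"
    proof (rule has_derivative_transform_within_open[OF has_derivative_inner_left[OF D2_derivative[OF y(1)]] open_W y(1)])
      show "J x e' \<bullet> a = J x e' \<bullet> K x a" if "x \<in> W" for x
        using K_orthogonal[OF that, of "J x e'" a] e'(1) by (simp add: inner_diff_left inner_commute[of "J x e'"])
    qed
    ultimately have "(\<lambda>e. J y e' \<bullet> D a e + D2 y e e' \<bullet> K y a) = (\<lambda>e. D2 y e e' \<bullet> a)"
      by (rule has_derivative_unique)
    from fun_cong[OF this, of e] have "K y b \<bullet> D a e = (a - K y a) \<bullet> D2 y e e'"
      by (simp add: e'(2) inner_diff_right inner_commute[of "a - K y a"])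
    then show ?thesis
      using second_form_le[OF y K_normal[OF y] e e'(1), of a] by (simp add: e'(2) mult.commute mult.left_commute)
  qed
  let ?b = "D a e"
  \<comment> \<open>Cauchy-Schwarz in the plane for the pairs of normal and tangential lengths of
    \<open>a\<close> and of \<open>?b\<close>, the latter pair exchanged.\<close>
  have cs: "norm (a - K y a) * norm (K y ?b) + norm (?b - K y ?b) * norm (K y a) \<le> norm a * norm ?b"
  proof (rule power2_le_imp_le)
    have "(norm (a - K y a) * norm (K y ?b) + norm (?b - K y ?b) * norm (K y a))\<^sup>2
        \<le> ((norm (K y a))\<^sup>2 + (norm (a - K y a))\<^sup>2) * ((norm (K y ?b))\<^sup>2 + (norm (?b - K y ?b))\<^sup>2)"
      using zero_le_power2[of "norm (a - K y a) * norm (?b - K y ?b) - norm (K y a) * norm (K y ?b)"]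
      by (simp add: power2_eq_square algebra_simps)
    also have "\<dots> = (norm a * norm ?b)\<^sup>2"
      unfolding K_pythagoras[OF y(1)] by (simp add: power_mult_distrib)
    finally show "(norm (a - K y a) * norm (K y ?b) + norm (?b - K y ?b) * norm (K y a))\<^sup>2 \<le> (norm a * norm ?b)\<^sup>2" .
  qed simp
  have "norm ?b * norm ?b = K y a \<bullet> D ?b e + K y ?b \<bullet> ?b"
    using prod[of a ?b] by (simp add: power2_norm_eq_inner[symmetric] power2_eq_square inner_commute)
  also have "\<dots> \<le> norm (J y e) / r * (norm (?b - K y ?b) * norm (K y a)) + norm (J y e) / r * (norm (a - K y a) * norm (K y ?b))"
    using half[of a ?b] half[of ?b a] by linarith
  also have "\<dots> = norm (J y e) / r * (norm (a - K y a) * norm (K y ?b) + norm (?b - K y ?b) * norm (K y a))"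
    by (simp only: distrib_left add.commute)
  also have "\<dots> \<le> norm (J y e) / r * (norm a * norm ?b)"
    using cs r_pos by (intro mult_left_mono) auto
  finally have "norm ?b * norm ?b \<le> norm (J y e) / r * norm a * norm ?b" by (simp add: mult.assoc)
  from mult_right_le_imp_le[OF this] show ?thesis
    using r_pos by (cases "?b = 0") auto
qed

end

section \<open>Chart-free estimates for the projections and the differential\<close>

locale reach_submanifold = reach_bound M r for M :: "'a::euclidean_space set" and r :: real +
  fixes k :: nat
  assumes submanifold: "smooth_submanifold k M"
begin

lemma chart_at:
  assumes "p \<in> M"
  obtains U W \<phi> \<psi> L y where "reach_chart M U W \<phi> \<psi> L r" "y \<in> W" "y \<in> L" "\<psi> y = p"
proof -
  obtain U W :: "'a set" and \<phi> \<psi> L where c: "open U" "p \<in> U" "open W" "homeomorphism U W \<phi> \<psi>"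
    "smooth_on U \<phi>" "smooth_on W \<psi>" "subspace L" "\<phi> ` (U \<inter> M) = W \<inter> L"
    using submanifold[unfolded smooth_submanifold_def, rule_format, OF assms]
    by (elim exE conjE) (rule that)
  interpret reach_chart M U W \<phi> \<psi> L r
    by unfold_locales (fact c)+
  show thesis
    by (rule that[OF reach_chart_axioms phi_in_W[OF c(2)] phi_in_L[OF c(2) assms] psi_phi[OF c(2)]])
qed

lemma subspace_tangent_space: "p \<in> M \<Longrightarrow> subspace (tangent_space_at M p)"
proof -
  assume "p \<in> M"
  then obtain U W \<phi> \<psi> L y where "reach_chart M U W \<phi> \<psi> L r" and y: "y \<in> W" "y \<in> L" "\<psi> y = p"
    by (rule chart_at)
  then interpret reach_chart M U W \<phi> \<psi> L r by simp
  show ?thesis using subspace_tangent[OF y(1)] tangent_space_eq[OF y(1,2)] y(3) by simp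
qed

lemma closest_point_derivative:
  assumes "p \<in> M" "v \<in> normal_space_at M p" "norm v < r"
  defines "A \<equiv> frechet_derivative (closest_point M) (at (p + v))"
  shows "(closest_point M has_derivative A) (at (p + v))"
    and "A h \<in> tangent_space_at M p"
    and "t \<in> tangent_space_at M p \<Longrightarrow> \<bar>(h - A h) \<bullet> t\<bar> \<le> norm v / r * norm (A h) * norm t"
proof -
  obtain U W \<phi> \<psi> L y where "reach_chart M U W \<phi> \<psi> L r" and y: "y \<in> W" "y \<in> L" "\<psi> y = p"
    using assms(1) by (rule chart_at)
  then interpret reach_chart M U W \<phi> \<psi> L r by simp
  have T: "tangent_space_at M p = J y ` L" using tangent_space_eq[OF y(1,2)] y(3) by simp
  obtain A' where A': "(closest_point M has_derivative A') (at (p + v))"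
    "\<And>h. A' h \<in> tangent_space_at M p"
    "\<And>h t. t \<in> tangent_space_at M p \<Longrightarrow> \<bar>(h - A' h) \<bullet> t\<bar> \<le> norm v / r * norm (A' h) * norm t"
    using closest_point_derivative_in_chart[OF y(1,2), of v] assms(2,3) unfolding y(3) T by blast
  have "A' = A" unfolding A_def by (rule frechet_derivative_at[OF A'(1)])
  with A' show "(closest_point M has_derivative A) (at (p + v))" "A h \<in> tangent_space_at M p"
    "t \<in> tangent_space_at M p \<Longrightarrow> \<bar>(h - A h) \<bullet> t\<bar> \<le> norm v / r * norm (A h) * norm t"
    by auto
qed

text \<open>For \<open>p \<in> M\<close> this is the orthogonal projection onto the tangent space:
  it is the case \<open>v = 0\<close> of the estimate for the differential, whose error factor
  \<open>norm v / r\<close> is then 0.\<close>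

definition Q :: "'a \<Rightarrow> 'a \<Rightarrow> 'a" where
  "Q p = frechet_derivative (closest_point M) (at p)"

lemma zero_normal: "0 \<in> normal_space_at M p"
  by (simp add: normal_space_at_def subspace_0 subspace_orthogonal_comp)

lemma Q_tangent: "p \<in> M \<Longrightarrow> Q p u \<in> tangent_space_at M p"
  using closest_point_derivative(2)[of p 0] r_pos by (simp add: Q_def zero_normal)

lemma Q_orthogonal: "p \<in> M \<Longrightarrow> t \<in> tangent_space_at M p \<Longrightarrow> (u - Q p u) \<bullet> t = 0"
  using closest_point_derivative(3)[of p 0 t u] r_pos by (simp add: Q_def zero_normal)

lemma norm_reflection:
  assumes "p \<in> M" shows "norm (2 *\<^sub>R Q p u - u) = norm u"
proof -
  have "(u - Q p u) \<bullet> Q p u = 0" by (rule Q_orthogonal[OF assms Q_tangent[OF assms]])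
  then have "(norm (2 *\<^sub>R Q p u - u))\<^sup>2 = (norm u)\<^sup>2"
    unfolding power2_norm_eq_inner by (simp add: inner_diff_left inner_diff_right inner_commute)
  then show ?thesis by simp
qed

lemma norm_Q_le: assumes "p \<in> M" shows "norm (Q p u) \<le> norm u"
proof -
  have "2 * norm (Q p u) \<le> norm (2 *\<^sub>R Q p u - u) + norm u"
    using norm_triangle_ineq[of "2 *\<^sub>R Q p u - u" u] by simp
  then show ?thesis using norm_reflection[OF assms, of u] by simp
qed

text \<open>The tangential part of \<open>h - A h\<close> is \<open>Q p h - A h\<close>, and testing
  the estimate for \<open>A\<close> with this very vector gives the first bound. As
  \<open>norm v < r\<close>, the resulting multiple of \<open>norm (A h)\<close> can be absorbed on
  the left, whence the denominator \<open>r - norm v\<close>.\<close>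

lemma closest_point_derivative_near_Q:
  assumes "p \<in> M" "v \<in> normal_space_at M p" "norm v < r"
  defines "A \<equiv> frechet_derivative (closest_point M) (at (p + v))"
  shows "norm (Q p h - A h) \<le> norm v / r * norm (A h)"
    and "norm (A h) \<le> r / (r - norm v) * norm h"
    and "norm (A h - Q p h) \<le> norm v / (r - norm v) * norm h"
proof -
  have A: "A h \<in> tangent_space_at M p"
    "\<And>t. t \<in> tangent_space_at M p \<Longrightarrow> \<bar>(h - A h) \<bullet> t\<bar> \<le> norm v / r * norm (A h) * norm t"
    unfolding A_def using closest_point_derivative(2,3)[OF assms(1-3)] by auto
  let ?t = "Q p h - A h"
  have t: "?t \<in> tangent_space_at M p"
    using subspace_diff[OF subspace_tangent_space[OF assms(1)] Q_tangent[OF assms(1)] A(1)] .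
  have "norm ?t * norm ?t = (h - A h) \<bullet> ?t - (h - Q p h) \<bullet> ?t"
    by (simp add: inner_diff_left[symmetric] power2_eq_square[symmetric] power2_norm_eq_inner)
  also have "\<dots> = (h - A h) \<bullet> ?t" using Q_orthogonal[OF assms(1) t] by simp
  also have "\<dots> \<le> norm v / r * norm (A h) * norm ?t" using A(2)[OF t] by simp
  finally have "norm ?t * norm ?t \<le> norm v / r * norm (A h) * norm ?t" .
  from mult_right_le_imp_le[OF this] show 1: "norm ?t \<le> norm v / r * norm (A h)"
    using r_pos by (cases "?t = 0") auto
  have "norm (A h) \<le> norm (Q p h) + norm ?t"
    using norm_triangle_ineq[of "Q p h" "- ?t"] by (simp add: norm_minus_commute)
  also have "\<dots> \<le> norm h + norm v / r * norm (A h)" using 1 norm_Q_le[OF assms(1), of h] by simp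
  finally have "(r - norm v) * norm (A h) \<le> r * norm h" using r_pos by (simp add: field_simps)
  then show 2: "norm (A h) \<le> r / (r - norm v) * norm h" using assms(3) by (simp add: field_simps)
  have "norm (A h - Q p h) \<le> norm v / r * norm (A h)" using 1 by (simp add: norm_minus_commute)
  also have "\<dots> \<le> norm v / r * (r / (r - norm v) * norm h)" using 2 r_pos by (intro mult_left_mono) auto
  also have "\<dots> = norm v / (r - norm v) * norm h" using r_pos by simp
  finally show "norm (A h - Q p h) \<le> norm v / (r - norm v) * norm h" .
qed

text \<open>Inside a chart \<open>Q (\<gamma> t)\<close> is \<open>K\<close> at
  \<open>\<phi> (\<gamma> t)\<close>, so the chain rule applies. The bound for the derivative of
  \<open>K\<close> sees the chart only through \<open>J y e\<close>, which is the velocity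
  \<open>w\<close>.\<close>

lemma Q_along_curve:
  assumes \<gamma>: "(\<gamma> has_vector_derivative w) (at s)" and \<gamma>M: "\<And>t. \<gamma> t \<in> M"
  shows "\<exists>D. ((\<lambda>t. Q (\<gamma> t) u) has_vector_derivative D) (at s) \<and> norm D \<le> norm w / r * norm u"
proof -
  obtain U W \<phi> \<psi> L y where "reach_chart M U W \<phi> \<psi> L r" and y: "y \<in> W" "y \<in> L" "\<psi> y = \<gamma> s"
    using \<gamma>M by (rule chart_at)
  then interpret reach_chart M U W \<phi> \<psi> L r by simp
  obtain e where e: "e \<in> L" "((\<lambda>t. \<phi> (\<gamma> t)) has_vector_derivative e) (at s)" "J y e = w"
    using curve_derivative_in_chart[OF \<gamma> _ y(3)[symmetric] y(1)] \<gamma>M by auto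
  define D where "D = (\<lambda>u. frechet_derivative (\<lambda>x. K x u) (at y))"
  have D: "((\<lambda>x. K x u) has_derivative D u) (at y)" for u
    unfolding D_def using K_differentiable[OF y(1)] by (simp add: frechet_derivative_works)
  have phis: "\<phi> (\<gamma> s) = y" using phi_psi[OF y(1)] y(3) by simp
  have KD: "((\<lambda>t. K (\<phi> (\<gamma> t)) u) has_vector_derivative D u e) (at s)"
    using has_derivative_compose[OF e(2)[unfolded has_vector_derivative_def], of "\<lambda>x. K x u" "D u"] D phis
      linear_scale[OF has_derivative_linear[OF D]]
    by (simp add: has_vector_derivative_def)
  have KQ: "K (\<phi> (\<gamma> t)) u = Q (\<gamma> t) u" if "\<gamma> t \<in> U" for t
  proof -
    have x: "\<phi> (\<gamma> t) \<in> W" "\<phi> (\<gamma> t) \<in> L" "\<psi> (\<phi> (\<gamma> t)) = \<gamma> t"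
      using that \<gamma>M by (auto simp: phi_in_W phi_in_L psi_phi)
    show ?thesis
      unfolding K_def using Q_tangent[OF \<gamma>M] Q_orthogonal[OF \<gamma>M] tangent_space_eq[OF x(1,2)] x(3)
      by (intro closest_point_subspace_eqI subspace_tangent x) auto
  qed
  obtain T where T: "open T" "s \<in> T" "\<And>t. t \<in> T \<Longrightarrow> \<gamma> t \<in> U"
  proof -
    have "isCont \<gamma> s" using \<gamma> has_vector_derivative_continuous by blast
    then have "\<forall>\<^sub>F t in nhds s. \<gamma> t \<in> U"
      using open_U psi_in_U[OF y(1)] y(3)
      unfolding isCont_def eventually_nhds_conv_at by (auto dest: topological_tendstoD)
    then show thesis unfolding eventually_nhds using that by blast
  qed
  have "((\<lambda>t. Q (\<gamma> t) u) has_vector_derivative D u e) (at s)"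
    by (rule has_vector_derivative_transform_within_open[OF KD T(1,2)]) (rule KQ[OF T(3)])
  moreover have "norm (D u e) \<le> norm w / r * norm u"
    using K_derivative_le[where D=D and a=u, OF y(1,2) e(1) D] e(3) by simp
  ultimately show ?thesis by (intro exI conjI)
qed

text \<open>Stewart's theorem: for \<open>n\<close> the unit vector along \<open>x - closest_point M x\<close>, the ball of
  radius \<open>r\<close> about \<open>closest_point M x + r n\<close> contains neither \<open>p\<close> nor \<open>q\<close> in its interior, so the
  squared distance of the chord point \<open>x\<close> to the centre is at least \<open>r\<^sup>2 - s (1 - s) (norm (p - q))\<^sup>2\<close>.\<close>

lemma residual_on_chord:
  assumes p: "p \<in> M" and q: "q \<in> M" and s: "0 \<le> s" "s \<le> 1" and pq: "norm (p - q) < r"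
  defines "x \<equiv> p + s *\<^sub>R (q - p)"
  shows "norm (x - closest_point M x) < r"
    and "sqrt (r\<^sup>2 - (norm (p - q))\<^sup>2 / 4) \<le> r - norm (x - closest_point M x)"
proof -
  define c v a where "c = closest_point M x" and "v = x - c" and "a = norm (p - q)"
  have c: "c \<in> M" "v \<in> normal_space_at M c"
    using closest_point_in[OF p] residual_normal[OF p] by (auto simp: c_def v_def)
  have "norm v \<le> dist x p"
    using closest_point_le[OF compact_imp_closed[OF compact_M] p, of x] by (simp add: v_def c_def dist_norm)
  also have "\<dots> \<le> a"
    using s by (simp add: x_def a_def dist_norm norm_minus_commute mult_left_le_one_le)
  finally have va: "norm v \<le> a" .
  then show lt: "norm (x - closest_point M x) < r" using pq by (simp add: v_def c_def a_def)
  have "2 * r * (v \<bullet> (p - c)) \<le> norm v * (norm (p - c))\<^sup>2" "2 * r * (v \<bullet> (q - c)) \<le> norm v * (norm (q - c))\<^sup>2"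
    by (rule ball_bound[OF c(1) _ c(2)]; fact)+
  then have "(1 - s) * (2 * r * (v \<bullet> (p - c))) + s * (2 * r * (v \<bullet> (q - c)))
      \<le> (1 - s) * (norm v * (norm (p - c))\<^sup>2) + s * (norm v * (norm (q - c))\<^sup>2)"
    using s by (intro add_mono mult_left_mono) auto
  moreover have "(1 - s) * (2 * r * (v \<bullet> (p - c))) + s * (2 * r * (v \<bullet> (q - c))) = 2 * r * (v \<bullet> v)"
  proof -
    have "v = (1 - s) *\<^sub>R (p - c) + s *\<^sub>R (q - c)" by (simp add: v_def x_def algebra_simps)
    then have "v \<bullet> v = (1 - s) * (v \<bullet> (p - c)) + s * (v \<bullet> (q - c))"
      by (metis inner_add_right inner_scaleR_right)
    moreover have "(1 - s) * (2 * r * \<alpha>) + s * (2 * r * \<beta>) = 2 * r * ((1 - s) * \<alpha> + s * \<beta>)" for \<alpha> \<beta>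
      by (simp add: algebra_simps)
    ultimately show ?thesis by simp
  qed
  moreover have "(1 - s) * (norm v * (norm (p - c))\<^sup>2) + s * (norm v * (norm (q - c))\<^sup>2)
      = norm v * ((norm v)\<^sup>2 + s * (1 - s) * a\<^sup>2)"
  proof -
    have pc: "p - c = v - s *\<^sub>R (q - p)" and qc: "q - c = v + (1 - s) *\<^sub>R (q - p)"
      by (simp_all add: v_def x_def algebra_simps)
    have "(1 - s) * (norm (p - c))\<^sup>2 + s * (norm (q - c))\<^sup>2 = (norm v)\<^sup>2 + s * (1 - s) * (norm (q - p))\<^sup>2"
      unfolding pc qc power2_norm_eq_inner
      by (simp add: inner_add_left inner_add_right inner_diff_left inner_diff_right inner_commute algebra_simps power2_eq_square)
    moreover have "(1 - s) * (norm v * \<alpha>) + s * (norm v * \<beta>) = norm v * ((1 - s) * \<alpha> + s * \<beta>)" for \<alpha> \<beta>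
      by (simp add: algebra_simps)
    ultimately show ?thesis by (simp add: a_def norm_minus_commute)
  qed
  ultimately have "norm v * (2 * r * norm v) \<le> norm v * ((norm v)\<^sup>2 + s * (1 - s) * a\<^sup>2)"
    by (simp add: power2_norm_eq_inner[symmetric] power2_eq_square algebra_simps)
  then have "2 * r * norm v \<le> (norm v)\<^sup>2 + s * (1 - s) * a\<^sup>2"
    using s by (cases "v = 0") (auto simp: mult_le_cancel_left)
  also have "s * (1 - s) * a\<^sup>2 \<le> 1 / 4 * a\<^sup>2"
    using zero_le_power2[of "s - 1/2"] by (intro mult_right_mono) (auto simp: power2_eq_square algebra_simps)
  finally have "r\<^sup>2 - a\<^sup>2 / 4 \<le> (r - norm v)\<^sup>2"
    by (simp add: power2_eq_square algebra_simps)
  then show "sqrt (r\<^sup>2 - (norm (p - q))\<^sup>2 / 4) \<le> r - norm (x - closest_point M x)"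
    using lt by (intro real_le_lsqrt) (auto simp: v_def c_def a_def)
qed

lemma Q_diff_le:
  assumes p: "p \<in> M" and q: "q \<in> M"
  shows "norm (Q p u - Q q u) \<le> norm (p - q) / r * norm u"
proof -
  have unit: "norm (Q p u - Q q u) \<le> norm (p - q) / r" if u: "norm u = 1" for u
  proof (cases "norm (p - q) < r")
    case False
    \<comment> \<open>Two reflections of a unit vector are at most 2 apart, so the left side never
      exceeds 1, which suffices at distance \<open>r\<close> or more.\<close>
    have "2 *\<^sub>R (Q p u - Q q u) = (2 *\<^sub>R Q p u - u) - (2 *\<^sub>R Q q u - u)" by (simp add: algebra_simps)
    then have "2 * norm (Q p u - Q q u) \<le> norm (2 *\<^sub>R Q p u - u) + norm (2 *\<^sub>R Q q u - u)"
      by (metis norm_triangle_ineq4 norm_scaleR abs_numeral)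
    then have "norm (Q p u - Q q u) \<le> 1"
      using norm_reflection[OF p, of u] norm_reflection[OF q, of u] u by simp
    also have "1 \<le> norm (p - q) / r" using False r_pos by simp
    finally show ?thesis .
  next
    case True
    \<comment> \<open>\<open>\<xi>\<close> bounds the speed of \<open>Q (\<gamma> s) u\<close>: the
      differential stretches \<open>q - p\<close> by at most \<open>r / (r - norm ?v)\<close>, the
      chord estimate gives \<open>r - norm ?v \<ge> r * sqrt (1 - X\<^sup>2 / 4)\<close>, and the
      projection moves at most at the speed of \<open>\<gamma>\<close> divided by
      \<open>r\<close>.\<close>
    define a X \<xi> where "a = norm (p - q)" and "X = a / r" and "\<xi> = X / sqrt (1 - X\<^sup>2 / 4)"
    have a: "0 \<le> a" "a < r" using True by (auto simp: a_def)
    have X: "0 \<le> X" "X \<le> 1" using a r_pos by (auto simp: X_def)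
    note arc = sin_arc_le[OF X, folded \<xi>_def]
    define \<gamma> where "\<gamma> = (\<lambda>s. closest_point M (p + s *\<^sub>R (q - p)))"
    have \<gamma>M: "\<gamma> s \<in> M" for s unfolding \<gamma>_def by (rule closest_point_in[OF p])
    define w where "w = (\<lambda>s. 2 *\<^sub>R Q (\<gamma> s) u - u)"
    have "\<exists>D. (w has_vector_derivative D) (at s within {0..1}) \<and> norm D \<le> 2 * \<xi>" if s: "s \<in> {0..1}" for s
    proof -
      let ?x = "p + s *\<^sub>R (q - p)"
      let ?v = "?x - \<gamma> s"
      let ?A = "frechet_derivative (closest_point M) (at ?x)"
      have v: "?v \<in> normal_space_at M (\<gamma> s)" unfolding \<gamma>_def by (rule residual_normal[OF p])
      have vr: "norm ?v < r" and ge: "sqrt (r\<^sup>2 - a\<^sup>2 / 4) \<le> r - norm ?v"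
        using residual_on_chord[OF p q _ _ True, of s] s by (auto simp: \<gamma>_def a_def)
      have A: "(closest_point M has_derivative ?A) (at ?x)"
        using closest_point_derivative(1)[OF \<gamma>M v vr] by simp
      have "(\<gamma> has_derivative (\<lambda>h. ?A (h *\<^sub>R (q - p)))) (at s)"
        unfolding \<gamma>_def
        by (rule has_derivative_compose[where f="\<lambda>s. p + s *\<^sub>R (q - p)", OF _ A]) (auto intro!: derivative_eq_intros)
      then have \<gamma>': "(\<gamma> has_vector_derivative ?A (q - p)) (at s)"
        by (simp add: has_vector_derivative_def linear_scale[OF has_derivative_linear[OF A]])
      obtain D where D: "((\<lambda>t. Q (\<gamma> t) u) has_vector_derivative D) (at s)" "norm D \<le> norm (?A (q - p)) / r * norm u"
        using Q_along_curve[OF \<gamma>' \<gamma>M] by blast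
      have "r\<^sup>2 - a\<^sup>2 / 4 > 0" using a power_strict_mono[of a r 2] zero_le_power2[of a] by linarith
      then have sq: "sqrt (r\<^sup>2 - a\<^sup>2 / 4) > 0" by simp
      have "norm (?A (q - p)) \<le> r / (r - norm ?v) * a"
        using closest_point_derivative_near_Q(2)[OF \<gamma>M v vr, of "q - p"] by (simp add: a_def norm_minus_commute)
      then have "norm (?A (q - p)) / r \<le> r / (r - norm ?v) * a / r"
        using r_pos by (intro divide_right_mono) auto
      also have "\<dots> = a / (r - norm ?v)" using r_pos by simp
      finally have "norm D \<le> a / (r - norm ?v)" using D(2) u by simp
      also have "\<dots> \<le> a / sqrt (r\<^sup>2 - a\<^sup>2 / 4)"
        using ge sq a vr by (intro divide_left_mono mult_pos_pos) auto
      also have "sqrt (r\<^sup>2 - a\<^sup>2 / 4) = r * sqrt (1 - X\<^sup>2 / 4)"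
      proof -
        have "r\<^sup>2 - a\<^sup>2 / 4 = r\<^sup>2 * (1 - X\<^sup>2 / 4)" using r_pos by (simp add: X_def field_simps)
        then show ?thesis using r_pos by (simp add: real_sqrt_mult)
      qed
      also have "a / (r * sqrt (1 - X\<^sup>2 / 4)) = \<xi>" by (simp add: \<xi>_def X_def)
      finally have "norm (2 *\<^sub>R D) \<le> 2 * \<xi>" by simp
      moreover have "(w has_vector_derivative 2 *\<^sub>R D) (at s within {0..1})"
      proof (rule has_vector_derivative_at_within)
        show "(w has_vector_derivative 2 *\<^sub>R D) (at s)"
          using has_vector_derivative_diff[OF bounded_linear.has_vector_derivative[OF bounded_linear_scaleR_right[of 2] D(1)]
              has_vector_derivative_const[of u]]
          by (simp add: w_def)
      qed
      ultimately show ?thesis by blast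
    qed
    then obtain w' where w': "\<And>s. s \<in> {0..1} \<Longrightarrow> (w has_vector_derivative w' s) (at s within {0..1})"
      "\<And>s. s \<in> {0..1} \<Longrightarrow> norm (w' s) \<le> 2 * \<xi>"
      by metis
    have unit_w: "norm (w s) = 1" for s
      unfolding w_def using norm_reflection[OF \<gamma>M] u by simp
    \<comment> \<open>The angle between \<open>w 0\<close> and \<open>w 1\<close> is at most
      \<open>2 * \<xi> \<le> pi\<close>, so they are at most \<open>2 * sin \<xi>\<close> apart.
      That distance is twice the one between the projections, so the doubling by the reflection
      cancels.\<close>
    have "cos (2 * \<xi>) \<le> w 0 \<bullet> w 1"
      by (rule inner_ge_cos_speed_on_sphere[OF w'(1) unit_w w'(2)]) (use arc(1) in auto)
    moreover have "(norm (w 0 - w 1))\<^sup>2 = 2 - 2 * (w 0 \<bullet> w 1)"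
      using unit_w[of 0] unit_w[of 1] unfolding power2_norm_eq_inner
      by (simp add: inner_diff_left inner_diff_right norm_eq_1 inner_commute)
    moreover have "w 0 - w 1 = 2 *\<^sub>R (Q p u - Q q u)"
      using closest_point_self[OF p] closest_point_self[OF q] by (simp add: w_def \<gamma>_def algebra_simps)
    ultimately have "(2 * norm (Q p u - Q q u))\<^sup>2 \<le> (2 * sin \<xi>)\<^sup>2"
      by (simp add: cos_double_sin power_mult_distrib)
    moreover have "0 \<le> sin \<xi>"
    proof (rule sin_ge_zero)
      have "X\<^sup>2 \<le> 1" using X by (simp add: power_le_one)
      then show "0 \<le> \<xi>" using X by (simp add: \<xi>_def)
      show "\<xi> \<le> pi" using arc(1) pi_gt_zero by linarith
    qed
    ultimately have "norm (Q p u - Q q u) \<le> sin \<xi>"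
      using power2_le_imp_le[of "2 * norm (Q p u - Q q u)" "2 * sin \<xi>"] by simp
    then show ?thesis using arc(2) by (simp add: X_def a_def)
  qed
  have lin: "linear (Q p)" if "p \<in> M" for p
    using closest_point_derivative(1)[OF that zero_normal] r_pos has_derivative_linear by (auto simp: Q_def)
  show ?thesis
  proof (cases "u = 0")
    case True
    then show ?thesis using linear_0[OF lin[OF p]] linear_0[OF lin[OF q]] by simp
  next
    case False
    have "Q p u - Q q u = norm u *\<^sub>R (Q p (u /\<^sub>R norm u) - Q q (u /\<^sub>R norm u))"
      using False by (simp add: linear_scale[OF lin[OF p]] linear_scale[OF lin[OF q]] scaleR_diff_right)
    then have "norm (Q p u - Q q u) = norm u * norm (Q p (u /\<^sub>R norm u) - Q q (u /\<^sub>R norm u))" by simp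
    also have "\<dots> \<le> norm u * (norm (p - q) / r)" using False by (intro mult_left_mono unit) auto
    finally show ?thesis by (simp add: mult.commute)
  qed
qed

lemma closest_point_derivative_diff_le:
  assumes "m \<in> M" "z \<in> M" "v \<in> normal_space_at M m" "norm v < r"
  shows "norm (frechet_derivative (closest_point M) (at (m + v)) h - frechet_derivative (closest_point M) (at z) h)
    \<le> (norm (m - z) / r + norm v / (r - norm v)) * norm h"
proof -
  let ?A = "frechet_derivative (closest_point M) (at (m + v))"
  have "norm (?A h - Q z h) \<le> norm (?A h - Q m h) + norm (Q m h - Q z h)"
    using norm_triangle_ineq[of "?A h - Q m h" "Q m h - Q z h"] by simp
  also have "\<dots> \<le> norm v / (r - norm v) * norm h + norm (m - z) / r * norm h"
    using closest_point_derivative_near_Q(3)[OF assms(1,3,4)] Q_diff_le[OF assms(1,2)] by (intro add_mono)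
  finally show ?thesis by (simp add: Q_def distrib_right)
qed

end

section \<open>From the reach to tangent balls\<close>

lemma ball_bound_of_le_reach:
  fixes M :: "'a::euclidean_space set"
  assumes "compact M" "0 < r" "ereal r \<le> reach M"
    and p: "p \<in> M" and q: "q \<in> M" and u: "u \<in> normal_space_at M p"
  shows "2 * r * (u \<bullet> (q - p)) \<le> norm u * (norm (q - p))\<^sup>2"
proof (cases "u \<bullet> (q - p) \<le> 0")
  case True
  then have "2 * r * (u \<bullet> (q - p)) \<le> 0" using assms(2) by (simp add: mult_nonneg_nonpos)
  also have "0 \<le> norm u * (norm (q - p))\<^sup>2" by simp
  finally show ?thesis .
next
  case False
  have u0: "norm u > 0" using False by auto
  have clM: "closed M" using assms(1) by (rule compact_imp_closed)
  have "s \<le> norm u * (norm (q - p))\<^sup>2 / (2 * (u \<bullet> (q - p)))" if s: "0 < s" "s < r" for s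
  proof -
    \<comment> \<open>The centre is put at distance \<open>s < r\<close>, which keeps
      \<open>v\<close> strictly inside the tube; density of the reals later raises \<open>s\<close>
      to \<open>r\<close>.\<close>
    define v where "v = (s / norm u) *\<^sub>R u"
    define c where "c = closest_point M (p + v)"
    have nv: "norm v = s" using s u0 by (simp add: v_def)
    have "v \<in> normal_space_at M p"
      using u unfolding v_def normal_space_at_def by (rule subspace_scale[OF subspace_orthogonal_comp])
    then have 1: "(p, v) \<in> normal_tube M (reach M)"
      using p nv s assms(3) by (auto simp: normal_tube_def intro: less_le_trans[of _ "ereal r"])
    have cM: "c \<in> M" using closest_point_in_set[OF clM] p by (auto simp: c_def)
    have "norm (p + v - c) \<le> norm v"
      using closest_point_le[OF clM p, of "p + v"] by (simp add: c_def dist_norm)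
    moreover have "p + v - c \<in> normal_space_at M c"
      unfolding c_def using clM p by (intro closest_point_residual_normal) auto
    ultimately have 2: "(c, p + v - c) \<in> normal_tube M (reach M)"
      using cM nv s assms(3) by (auto simp: normal_tube_def intro: le_less_trans[of _ "ereal s"] less_le_trans[of _ "ereal r"])
    \<comment> \<open>Both pairs are normal decompositions of the point \<open>p + v\<close> inside
      the tube, so injectivity makes \<open>p\<close> its closest point. Hence \<open>q\<close> is
      no closer to the centre than \<open>p\<close>.\<close>
    have "(c, p + v - c) = (p, v)"
      by (rule inj_onD[OF inj_on_normal_tube_iff_le_reach[THEN iffD2, OF order_refl] _ 2 1]) simp
    then have "c = p" by (rule Pair_inject)
    then have "dist (p + v) p \<le> dist (p + v) q"
      using closest_point_le[OF clM q, of "p + v"] unfolding c_def by simp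
    moreover have "p + v - q = v - (q - p)" by simp
    ultimately have "norm v \<le> norm (v - (q - p))" by (simp only: dist_norm add_diff_cancel_left')
    then have "v \<bullet> v \<le> (v - (q - p)) \<bullet> (v - (q - p))" by (simp add: norm_le)
    then have "2 * (v \<bullet> (q - p)) \<le> (norm (q - p))\<^sup>2"
      unfolding power2_norm_eq_inner by (simp add: inner_diff_left inner_diff_right inner_commute)
    then have "2 * (s / norm u * (u \<bullet> (q - p))) \<le> (norm (q - p))\<^sup>2" by (simp add: v_def)
    then show ?thesis using u0 False by (simp add: field_simps)
  qed
  then have "r \<le> norm u * (norm (q - p))\<^sup>2 / (2 * (u \<bullet> (q - p)))"
    using assms(2) by (rule_tac dense_le_bounded[of 0]) auto
  then show ?thesis using False by (simp add: field_simps)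
qed

theorem theorem2p10:
  fixes M :: "(real ^ 'd) set" and m z v :: "real ^ 'd" and k :: nat and \<tau> :: ereal
  assumes "smooth_submanifold k M" and "compact M"
    and "reach M = \<tau>"
    and "m \<in> M" and "z \<in> M"
    and "v \<in> normal_space_at M m" and "ereal (norm v) < \<tau>"
  shows "ereal (onorm (\<lambda>h. frechet_derivative (closest_point M) (at (m + v)) h
                          - frechet_derivative (closest_point M) (at z) h))
           \<le> 1 / \<tau> * ereal (norm (m - z)) + 1 / (\<tau> - ereal (norm v)) * ereal (norm v)
       \<and> 1 / \<tau> * ereal (norm (m - z)) + 1 / (\<tau> - ereal (norm v)) * ereal (norm v)
           \<le> (2 / \<tau> + 1 / (\<tau> - ereal (norm v))) * ereal (norm (m + v - z))"
proof -
  let ?N = "onorm (\<lambda>h. frechet_derivative (closest_point M) (at (m + v)) h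
                          - frechet_derivative (closest_point M) (at z) h)"
  have reach_sub: "reach_submanifold M r k" if "norm v < r" "ereal r \<le> \<tau>" for r
    using ball_bound_of_le_reach[of M r] assms(1-3) that le_less_trans[OF norm_ge_zero that(1)]
    by unfold_locales auto
  have bound: "?N \<le> norm (m - z) / r + norm v / (r - norm v)" if "norm v < r" "ereal r \<le> \<tau>" for r
    using reach_submanifold.closest_point_derivative_diff_le[OF reach_sub[OF that] assms(4-6) that(1)]
    by (rule onorm_le)
  obtain r0 where r0: "norm v < r0" "ereal r0 \<le> \<tau>"
    using ereal_dense2[OF assms(7)] by (metis ereal_less_eq(3) less_ereal.simps(1) less_imp_le)
  interpret R: reach_submanifold M r0 k by (rule reach_sub[OF r0])
  \<comment> \<open>\<open>m\<close> is the closest point of \<open>m + v\<close>, so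
    \<open>norm v\<close> is the distance of \<open>m + v\<close> from \<open>M\<close>. The
    triangle inequality then produces the factor 2 in the last estimate.\<close>
  have "norm v \<le> norm (m + v - z)"
    using closest_point_le[OF compact_imp_closed[OF assms(2)] assms(5), of "m + v"]
      R.closest_point_eq[OF assms(4,6) r0(1)] by (simp add: dist_norm)
  moreover have "norm (m - z) \<le> norm (m + v - z) + norm v"
    using norm_triangle_ineq4[of "m + v - z" v] by simp
  ultimately have le: "norm v \<le> norm (m + v - z)" "norm (m - z) \<le> 2 * norm (m + v - z)" by auto
  show ?thesis
  proof (cases \<tau>)
    case (real r)
    then have r: "norm v < r" "ereal r \<le> \<tau>" using assms(7) by auto
    have "0 < r" using le_less_trans[OF norm_ge_zero r(1)] .
    have "norm (m - z) / r + norm v / (r - norm v)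
        \<le> 2 * norm (m + v - z) / r + norm (m + v - z) / (r - norm v)"
      using le r(1) \<open>0 < r\<close> by (intro add_mono divide_right_mono) auto
    then show ?thesis
      using bound[OF r] r(1) \<open>0 < r\<close> real
      by (auto simp: one_ereal_def numeral_eq_ereal algebra_simps)
  next
    case PInf
    \<comment> \<open>With infinite reach both right-hand expressions are 0, so the two
      differentials must agree. The real bound holds for every \<open>r > norm v\<close> and tends
      to 0 as \<open>r\<close> grows.\<close>
    have "filterlim (\<lambda>r. - norm v + r) at_top at_top"
      by (rule filterlim_tendsto_add_at_top[OF tendsto_const filterlim_ident])
    then have "((\<lambda>r. norm v / (- norm v + r)) \<longlongrightarrow> 0) at_top"
      by (intro tendsto_divide_0[OF tendsto_const] filterlim_at_top_imp_at_infinity)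
    moreover have "((\<lambda>r. norm (m - z) / r) \<longlongrightarrow> 0) at_top"
      by (intro tendsto_divide_0[OF tendsto_const] filterlim_at_top_imp_at_infinity filterlim_ident)
    ultimately have "((\<lambda>r. norm (m - z) / r + norm v / (r - norm v)) \<longlongrightarrow> 0) at_top"
      using tendsto_add by fastforce
    moreover have "\<forall>\<^sub>F r in at_top. ?N \<le> norm (m - z) / r + norm v / (r - norm v)"
      using eventually_gt_at_top[of "norm v"] by eventually_elim (use bound PInf in auto)
    ultimately have "?N \<le> 0"
      by (rule tendsto_lowerbound) simp
    then show ?thesis using PInf by simp
  next
    case MInf
    then show ?thesis using assms(7) by simp
  qed
qed

end
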